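(* Let $\gamma\in\mathbb R$, $1\le p\le q\le\infty$, and $(p,q)\ne(1,\infty)$. Let $x(n+1)=L(n)x_n+f(n)$, $n\ge0$, be a system of difference equations with bounded delay of order $d$. Then the following statements are equivalent: (i) The homogeneous system $x(n+1)=L(n)x_n$, $n\ge0$, is uniformly exponentially stable in $\mathcal X$ with respect to $\mathcal B^\gamma$ (or, equivalently, when $d\ge1$, with respect to $\mathcal B^\gamma_{[-d+1,0]}$). (ii) The nonhomogeneous system is $(\ell^p,\ell^q)$-stable.
   Context: $\mathbb Z^+$ and $\mathbb Z^-$ are the sets of nonnegative and nonpositive integers. $(\mathcal X,|\cdot|)$ is a (real or complex) Banach space. $\mathcal X^{\mathbb Z^-}$ is the vector space of all tuples $\varphi=(\varphi^{[m]})_{m\le 0}$ with $\varphi^{[m]}\in\mathcal X$; its zero vector is $0_{\mathcal B}$. For $\gamma\in\mathbb R$, $\mathcal B^\gamma=\{\varphi\in\mathcal X^{\mathbb Z^-}: |\varphi|_{\mathcal B^\gamma}:=\sup_{m\le 0}|\varphi^{[m]}|e^{\gamma m}<\infty\}$. For $j\in\mathbb Z^-$, $\mathcal B^\gamma_{[j,0]}$ is the vector space $\mathcal X^{\mathbb Z^-}$ with the seminorm $|\varphi|_{\mathcal B^\gamma_{[j,0]}}=\sup_{j\le m\le0}|\varphi^{[m]}|e^{\gamma m}$. For $1\le p\le\infty$, $\ell^p(\mathcal X)$ is the usual space of $p$-summable (bounded if $p=\infty$) functions $\mathbb Z^+\to\mathcal X$. For $x:\mathbb Z\to\mathcal X$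 and $n\in\mathbb Z$, the prehistory $x_n\in\mathcal X^{\mathbb Z^-}$ is defined by $x_n^{[m]}=x(n+m)$, $m\le 0$. System with bounded delay: for $k\in\mathbb Z^+$ let $L(n,k):\mathcal X\to\mathcal X$ be $L(n,k)\psi=L(n)E_{-k}\psi$, where $E_{-k}\psi$ has $(-k)$-th coordinate $\psi$ and all other coordinates zero; it is required that all $L(n,k)$ are bounded linear operators on $\mathcal X$ and that there is $m\in\mathbb Z^-$ with $L(n)P_{[-\infty,m]}=0$ for all $n\in\mathbb Z^+$, where $P_{[-\infty,m]}$ keeps the coordinates with index $\le m$ and replaces the others by zero. If $m$ is the largest nonpositive integer with this property, the order is $d=|m|$. Such a system has the form $x(n+1)=\sum_{k=0}^{d-1}L(n,k)x(n-k)+f(n)$, $n\in\mathbb Z^+$ (empty sums are zero), and is considered on all of $\mathcal X^{\mathbb Z^-}$, i.e. $L(n)\varphi=\sum_{k=0}^{d-1}L(n,k)\varphi^{[-k]}$; any of the spaces $\mathcal B^\gamma$ or $\mathcal B^\gamma_{[j,0]}$ with $j\le -d+1$, $j\in\mathbb Z^-$, can be taken as phase space. For $\tau\in\mathbb Z^+$, $\varphi\in\mathcal X^{\mathbb Z^-}$ and $f:\mathbb Z^+\to\mathcal X$, $x(\cdot,\tau,\varphi;f):\mathbb Z\to\mathcal X$ is the unique function $x$ with $x_\tau=\varphi$ and $x(n+1)=L(n)x_n+f(n)$ for all $n\ge\tau$; $\mathbf 0$ is the zero function $f$. The nonhomogeneous system is $(\ell^p,\ell^q)$-stable if $x(\cdot,0,0_{\mathcal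 B};f)$ (restricted to $\mathbb Z^+$) belongs to $\ell^q(\mathcal X)$ for every $f\in\ell^p(\mathcal X)$. For a seminormed phase space $\mathcal B$, the homogeneous system is uniformly exponentially stable in $\mathcal X$ with respect to $\mathcal B$ if there exist $K\ge1$, $\nu>0$ such that $|x(n,\tau,\varphi;\mathbf 0)|\le Ke^{-\nu(n-\tau)}|\varphi|_{\mathcal B}$ for all $n\ge\tau\ge0$ and all $\varphi\in\mathcal B$. *)

theory Defs
  imports "HOL-Analysis.Analysis"
begin

text \<open>
  A prehistory (an element of the space of all tuples in X indexed by the nonpositive integers)
  is a function \<open>nat \<Rightarrow> 'a\<close>: its value at \<open>k\<close> is the coordinate with index \<open>- k\<close>.
  A complex Banach space is in particular a real one and complex-linear maps are real-linear,
  so that working over the reals covers both scalar fields.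
\<close>

type_synonym 'a hist = "nat \<Rightarrow> 'a"

definition prehistory :: "(int \<Rightarrow> 'a) \<Rightarrow> int \<Rightarrow> 'a hist" where
  "prehistory x n = (\<lambda>k. x (n - int k))"

definition coord_hist :: "nat \<Rightarrow> 'a::zero \<Rightarrow> 'a hist" where
  "coord_hist k \<psi> = (\<lambda>i. if i = k then \<psi> else 0)"

text \<open>\<open>trunc_hist j\<close> keeps the coordinates with index at most \<open>- j\<close>.\<close>

definition trunc_hist :: "nat \<Rightarrow> 'a::zero hist \<Rightarrow> 'a hist" where
  "trunc_hist j \<phi> = (\<lambda>i. if j \<le> i then \<phi> i else 0)"

definition linear_on_hist :: "('a::real_vector hist \<Rightarrow> 'a) \<Rightarrow> bool" where
  "linear_on_hist A \<longleftrightarrow>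
     (\<forall>\<phi> \<psi>. A (\<lambda>k. \<phi> k + \<psi> k) = A \<phi> + A \<psi>) \<and>
     (\<forall>c \<phi>. A (\<lambda>k. c *\<^sub>R \<phi> k) = c *\<^sub>R A \<phi>)"

definition bounded_delay :: "(nat \<Rightarrow> 'a::real_normed_vector hist \<Rightarrow> 'a) \<Rightarrow> bool" where
  "bounded_delay L \<longleftrightarrow>
     (\<forall>n. linear_on_hist (L n)) \<and>
     (\<forall>n k. bounded_linear (\<lambda>\<psi>. L n (coord_hist k \<psi>))) \<and>
     (\<exists>j. \<forall>n \<phi>. L n (trunc_hist j \<phi>) = 0)"

text \<open>The largest nonpositive \<open>m = - j\<close> corresponds to the least \<open>j\<close>.\<close>

definition delay_order :: "(nat \<Rightarrow> 'a::zero hist \<Rightarrow> 'a) \<Rightarrow> nat" where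
  "delay_order L = (LEAST j. \<forall>n \<phi>. L n (trunc_hist j \<phi>) = 0)"

lemma bounded_delay_sum:
  assumes "bounded_delay L"
  shows "L n \<phi> = (\<Sum>k<delay_order L. L n (coord_hist k (\<phi> k)))"
proof -
  have add: "L n (\<lambda>k. \<phi> k + \<psi> k) = L n \<phi> + L n \<psi>" for \<phi> \<psi>
    using assms by (auto simp: bounded_delay_def linear_on_hist_def)
  have zero: "L n (trunc_hist (delay_order L) \<phi>) = 0"
    using assms LeastI_ex[of "\<lambda>j. \<forall>n \<phi>. L n (trunc_hist j \<phi>) = 0"]
    unfolding bounded_delay_def delay_order_def by blast
  have "L n \<phi> = (\<Sum>k<j. L n (coord_hist k (\<phi> k))) + L n (trunc_hist j \<phi>)" for j
  proof (induction j)
    case 0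
    have "trunc_hist 0 \<phi> = \<phi>" by (simp add: trunc_hist_def)
    then show ?case by simp
  next
    case (Suc j)
    have "trunc_hist j \<phi> = (\<lambda>k. coord_hist j (\<phi> j) k + trunc_hist (Suc j) \<phi> k)"
      by (intro ext) (auto simp: trunc_hist_def coord_hist_def not_less_eq_eq dest: le_antisym)
    then have "L n (trunc_hist j \<phi>) = L n (coord_hist j (\<phi> j)) + L n (trunc_hist (Suc j) \<phi>)"
      by (simp add: add)
    then show ?case using Suc by simp
  qed
  from this[of "delay_order L"] zero show ?thesis by simp
qed

definition is_solution ::
  "(nat \<Rightarrow> 'a::plus hist \<Rightarrow> 'a) \<Rightarrow> nat \<Rightarrow> 'a hist \<Rightarrow> (nat \<Rightarrow> 'a) \<Rightarrow> (int \<Rightarrow> 'a) \<Rightarrow> bool" where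
  "is_solution L \<tau> \<phi> f x \<longleftrightarrow>
     prehistory x (int \<tau>) = \<phi> \<and>
     (\<forall>n\<ge>\<tau>. x (int n + 1) = L n (prehistory x (int n)) + f n)"

definition solution ::
  "(nat \<Rightarrow> 'a::plus hist \<Rightarrow> 'a) \<Rightarrow> nat \<Rightarrow> 'a hist \<Rightarrow> (nat \<Rightarrow> 'a) \<Rightarrow> int \<Rightarrow> 'a" where
  "solution L \<tau> \<phi> f = (THE x. is_solution L \<tau> \<phi> f x)"

lemma prehistory_Suc:
  "prehistory x (int n + 1) = case_nat (x (int n + 1)) (prehistory x (int n))"
  by (auto simp: prehistory_def fun_eq_iff split: nat.split)

lemma ex1_solution: "\<exists>!x. is_solution L \<tau> \<phi> f x"
proof (rule ex_ex1I)
  define h where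
    "h = rec_nat \<phi> (\<lambda>i g. case_nat (L (\<tau> + i) g + f (\<tau> + i)) g)"
  have h0: "h 0 = \<phi>" and hS: "h (Suc i) = case_nat (L (\<tau> + i) (h i) + f (\<tau> + i)) (h i)" for i
    by (simp_all add: h_def)
  define x where "x = (\<lambda>t. h (nat (t - int \<tau>)) (nat (int \<tau> - t)))"
  have x0: "prehistory x (int \<tau>) = \<phi>"
    by (simp add: prehistory_def x_def h0)
  have xS: "x (int (\<tau> + i) + 1) = L (\<tau> + i) (h i) + f (\<tau> + i)" for i
  proof -
    have "nat (int (\<tau> + i) + 1 - int \<tau>) = Suc i" "nat (int \<tau> - (int (\<tau> + i) + 1)) = 0" by auto
    then show ?thesis unfolding x_def by (simp add: hS)
  qed
  have pre: "prehistory x (int (\<tau> + i)) = h i" for i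
  proof (induction i)
    case 0
    then show ?case using x0 by (simp add: h0)
  next
    case (Suc i)
    have "int (\<tau> + Suc i) = int (\<tau> + i) + 1" by simp
    then show ?case using prehistory_Suc[of x "\<tau> + i"] Suc xS[of i] hS[of i] by (simp add: ac_simps)
  qed
  have "x (int n + 1) = L n (prehistory x (int n)) + f n" if "n \<ge> \<tau>" for n
    using pre[of "n - \<tau>"] xS[of "n - \<tau>"] that by simp
  then show "\<exists>x. is_solution L \<tau> \<phi> f x"
    using x0 unfolding is_solution_def by blast
next
  fix x y assume x: "is_solution L \<tau> \<phi> f x" and y: "is_solution L \<tau> \<phi> f y"
  have pre: "prehistory x (int (\<tau> + i)) = prehistory y (int (\<tau> + i))" for i
  proof (induction i)
    case 0
    then show ?case using x y by (simp add: is_solution_def)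
  next
    case (Suc i)
    have "int (\<tau> + Suc i) = int (\<tau> + i) + 1" by simp
    moreover have "x (int (\<tau> + i) + 1) = y (int (\<tau> + i) + 1)"
      using x y Suc unfolding is_solution_def by (metis le_add1)
    ultimately show ?case
      using prehistory_Suc[of x "\<tau> + i"] prehistory_Suc[of y "\<tau> + i"] Suc by (simp add: ac_simps)
  qed
  show "x = y"
  proof
    fix t
    define i where "i = nat (t - int \<tau>)"
    define k where "k = nat (int (\<tau> + i) - t)"
    have "int (\<tau> + i) - int k = t" by (simp add: i_def k_def)
    then show "x t = y t"
      using fun_cong[OF pre[of i], of k] by (simp add: prehistory_def)
  qed
qed

definition lp :: "ennreal \<Rightarrow> (nat \<Rightarrow> 'a::real_normed_vector) set" where
  "lp p = {f. if p = \<infinity> then bounded (range f)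
              else summable (\<lambda>n. norm (f n) powr enn2real p)}"

definition lp_lq_stable ::
  "(nat \<Rightarrow> 'a::real_normed_vector hist \<Rightarrow> 'a) \<Rightarrow> ennreal \<Rightarrow> ennreal \<Rightarrow> bool" where
  "lp_lq_stable L p q \<longleftrightarrow>
     (\<forall>f \<in> lp p. (\<lambda>n. solution L 0 (\<lambda>_. 0) f (int n)) \<in> lp q)"

definition Bspace :: "real \<Rightarrow> 'a::real_normed_vector hist set" where
  "Bspace \<gamma> = {\<phi>. bdd_above (range (\<lambda>k. norm (\<phi> k) * exp (\<gamma> * (- real k))))}"

definition Bnorm :: "real \<Rightarrow> 'a::real_normed_vector hist \<Rightarrow> real" where
  "Bnorm \<gamma> \<phi> = (SUP k. norm (\<phi> k) * exp (\<gamma> * (- real k)))"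

text \<open>The supremum runs over the coordinates with index from \<open>- j\<close> to \<open>0\<close>.\<close>

definition Bseminorm :: "real \<Rightarrow> nat \<Rightarrow> 'a::real_normed_vector hist \<Rightarrow> real" where
  "Bseminorm \<gamma> j \<phi> = (SUP k\<in>{..j}. norm (\<phi> k) * exp (\<gamma> * (- real k)))"

text \<open>The phase space is given by its underlying set \<open>B\<close> and its seminorm \<open>N\<close>.\<close>

definition unif_exp_stable ::
  "(nat \<Rightarrow> 'a::real_normed_vector hist \<Rightarrow> 'a) \<Rightarrow> 'a hist set \<Rightarrow> ('a hist \<Rightarrow> real) \<Rightarrow> bool" where
  "unif_exp_stable L B N \<longleftrightarrow>
     (\<exists>K \<nu>. K \<ge> 1 \<and> \<nu> > 0 \<and>
       (\<forall>\<tau> n. \<forall>\<phi> \<in> B. n \<ge> \<tau> \<longrightarrow>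
          norm (solution L \<tau> \<phi> (\<lambda>_. 0) (int n))
            \<le> K * exp (- \<nu> * (real n - real \<tau>)) * N \<phi>))"

end

theory Submission
  imports Defs "HOL-Real_Asymp.Real_Asymp"
begin

text \<open>
  Exponential stability bounds the fundamental solution by a geometric kernel, so the response to a
  forcing term \<open>f\<close> is dominated by a geometric convolution of \<open>norm \<circ> f\<close>, which is \<open>p\<close>-summable.

  For the converse, monotonicity of the sequence spaces leaves the cases \<open>p = 1\<close>, \<open>q < \<infinity>\<close> and
  \<open>1 < p < \<infinity>\<close>, \<open>q = \<infinity>\<close>. A gliding hump argument makes the stability estimate uniform over the unit
  ball of forcing terms. Impulses then bound the coefficients uniformly in time, and cutting off the
  history of a homogeneous solution turns it into a forced solution with short, bounded forcing, so
  homogeneous solutions are uniformly bounded and their sums over windows of length \<open>N\<close> grow at most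
  like \<open>N powr (1 - 1/q)\<close>. If \<open>q < \<infinity>\<close>, averaging over a long window halves the solution (Datko);
  if \<open>p > 1\<close>, multiplying it by a ramp of length \<open>N\<close> does. Iterating the halving gives exponential
  decay.
\<close>

section \<open>Sequence spaces\<close>

text \<open>Tangent at 1 of a convex power, by the weighted arithmetic-geometric mean inequality for
  \<open>x powr P\<close> and 1 with weights \<open>1/P\<close> and \<open>1 - 1/P\<close>.\<close>

lemma powr_above_tangent:
  fixes P x :: real
  assumes "P \<ge> 1" "x \<ge> 0"
  shows "1 + P * (x - 1) \<le> x powr P"
proof (cases "x = 0")
  case False
  then have x: "x > 0" using assms by simp
  have "x = (x powr P) powr (1/P) * 1 powr (1 - 1/P)"
    using x assms by (simp add: powr_powr)
  also have "\<dots> \<le> (1/P) * x powr P + (1 - 1/P) * 1"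
    by (rule Youngs_inequality_0) (use assms x in auto)
  finally have "P * x \<le> P * ((1/P) * x powr P + (1 - 1/P) * 1)"
    using assms by (intro mult_left_mono) auto
  also have "\<dots> = x powr P + (P - 1)"
    using assms by (simp add: field_simps)
  finally show ?thesis by (simp add: algebra_simps)
qed (use assms in auto)

text \<open>Sum the tangent inequality at the weighted mean \<open>t\<close>. Total weight below 1
  leaves an extra multiple of \<open>(P - 1) * (1 - sum c J)\<close>, which is nonnegative, so
  subprobability weights suffice.\<close>

lemma jensen_powr:
  fixes P :: real and c a :: "'b \<Rightarrow> real"
  assumes P: "P \<ge> 1" and c: "\<And>j. j \<in> J \<Longrightarrow> c j \<ge> 0" and c1: "sum c J \<le> 1"
    and a: "\<And>j. j \<in> J \<Longrightarrow> a j \<ge> 0"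
  shows "(\<Sum>j\<in>J. c j * a j) powr P \<le> (\<Sum>j\<in>J. c j * a j powr P)"
proof (cases "(\<Sum>j\<in>J. c j * a j) = 0")
  case True
  then show ?thesis using c by (auto intro!: sum_nonneg)
next
  case False
  define t where "t = (\<Sum>j\<in>J. c j * a j)"
  have t: "t > 0"
    using False sum_nonneg[of J "\<lambda>j. c j * a j"] a c unfolding t_def by fastforce
  have "t powr P * (1 + P * (a j / t - 1)) \<le> a j powr P" if "j \<in> J" for j
  proof -
    have "t powr P * (1 + P * (a j / t - 1)) \<le> t powr P * (a j / t) powr P"
      using powr_above_tangent[OF P, of "a j / t"] a[OF that] t by (intro mult_left_mono) auto
    also have "\<dots> = a j powr P"
      using a[OF that] t by (simp add: powr_divide)
    finally show ?thesis .
  qed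
  then have "(\<Sum>j\<in>J. c j * (t powr P * (1 + P * (a j / t - 1)))) \<le> (\<Sum>j\<in>J. c j * a j powr P)"
    using c by (intro sum_mono mult_left_mono) auto
  also have "(\<Sum>j\<in>J. c j * (t powr P * (1 + P * (a j / t - 1)))) =
      (\<Sum>j\<in>J. (t powr P * (1 - P)) * c j + (t powr P * P / t) * (c j * a j))"
    by (intro sum.cong) (auto simp: algebra_simps)
  also have "\<dots> = t powr P * (1 - P) * sum c J + t powr P * P / t * t"
    unfolding t_def by (simp only: sum.distrib sum_distrib_left)
  also have "\<dots> = t powr P + t powr P * ((P - 1) * (1 - sum c J))"
    using t by (simp add: algebra_simps)
  finally have "t powr P + t powr P * ((P - 1) * (1 - sum c J)) \<le> (\<Sum>j\<in>J. c j * a j powr P)" .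
  moreover have "t powr P * ((P - 1) * (1 - sum c J)) \<ge> 0"
    using P c1 by (intro mult_nonneg_nonneg) auto
  ultimately show ?thesis unfolding t_def by linarith
qed

section \<open>Membership and inclusions of the sequence spaces\<close>

lemma lp_finite: "f \<in> lp (ennreal P) \<longleftrightarrow> summable (\<lambda>n. norm (f n) powr P)" if "P \<ge> 0"
  using that by (simp add: lp_def)

lemma lp_top: "f \<in> lp top \<longleftrightarrow> bounded (range f)"
  by (simp add: lp_def)

lemma ennreal_ge_1_cases:
  assumes "(1::ennreal) \<le> p"
  obtains (real) P where "P \<ge> 1" "p = ennreal P" | (top) "p = top"
proof (cases p)
  case (real r)
  then show ?thesis using assms that(1)[of r]
    by (metis ennreal_1 ennreal_le_iff)
next
  case top
  then show ?thesis using that(2) by simp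
qed

lemma lp_mono:
  assumes "1 \<le> p" "p \<le> q"
  shows "(lp p :: (nat \<Rightarrow> 'a::real_normed_vector) set) \<subseteq> lp q"
proof
  fix f :: "nat \<Rightarrow> 'a" assume f: "f \<in> lp p"
  from assms(1) show "f \<in> lp q"
  proof (cases rule: ennreal_ge_1_cases)
    case top
    then show ?thesis using assms f by (simp add: top_unique)
  next
    case (real P)
    then have sum: "summable (\<lambda>n. norm (f n) powr P)" using f by (simp add: lp_finite)
    then have "(\<lambda>n. norm (f n) powr P) \<longlonglongrightarrow> 0" by (rule summable_LIMSEQ_zero)
    then have "eventually (\<lambda>n. norm (f n) powr P < 1) sequentially"
      by (rule order_tendstoD) simp
    then obtain N where N: "\<And>n. n \<ge> N \<Longrightarrow> norm (f n) powr P < 1"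
      by (auto simp: eventually_sequentially)
    have le1: "norm (f n) \<le> 1" if "n \<ge> N" for n
    proof (rule ccontr)
      assume "\<not> norm (f n) \<le> 1"
      then have "norm (f n) powr P \<ge> 1" using real by (intro ge_one_powr_ge_zero) auto
      then show False using N[OF that] by simp
    qed
    have "1 \<le> q" using assms by order
    then show ?thesis
    proof (cases rule: ennreal_ge_1_cases)
      case top
      have "range f \<subseteq> f ` {..<N} \<union> f ` {N..}" by fastforce
      moreover have "bounded (f ` {N..})" by (rule boundedI[of _ 1]) (auto intro: le1)
      ultimately have "bounded (range f)"
        by (meson bounded_Un bounded_subset finite_imageI finite_imp_bounded finite_lessThan)
      then show ?thesis using top by (simp add: lp_top)
    next
      case (real Q)
      then have PQ: "P \<le> Q" using assms \<open>p = ennreal P\<close> by (simp add: ennreal_le_iff)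
      have "summable (\<lambda>n. norm (f n) powr Q)"
      proof (rule summable_comparison_test'[OF sum])
        fix n assume "n \<ge> N"
        then show "norm (norm (f n) powr Q) \<le> norm (f n) powr P"
          using le1[of n] PQ by (cases "f n = 0") (auto intro: powr_mono')
      qed
      then show ?thesis using real by (simp add: lp_finite)
    qed
  qed
qed

text \<open>Stated through partial sums, so that no separate summability condition is carried along
  and membership survives limits taken for fixed \<open>N\<close>.\<close>

definition lp_ball :: "real \<Rightarrow> (nat \<Rightarrow> 'a::real_normed_vector) set" where
  "lp_ball P = {f. \<forall>N. (\<Sum>n<N. norm (f n) powr P) \<le> 1}"

lemma lp_ball_norm_le: 
  assumes "f \<in> lp_ball P" "P \<ge> 1" shows "norm (f n) \<le> 1"
proof (rule ccontr)
  assume a: "\<not> ?thesis"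
  have "norm (f n) powr P \<le> (\<Sum>n<Suc n. norm (f n) powr P)" 
    by (rule member_le_sum) auto
  also have "\<dots> \<le> 1" using assms unfolding lp_ball_def by blast
  also have "1 < norm (f n) powr P" using a assms by (simp add: less_powr_iff gr_one_powr)
  finally show False by simp
qed

lemma lp_ball_subset_lp: 
  assumes "f \<in> lp_ball P" "P \<ge> 1" shows "f \<in> lp (ennreal P)"
proof -
  have "summable (\<lambda>n. norm (f n) powr P)"
  proof (rule bounded_imp_summable[of _ 1])
    show "(\<Sum>k\<le>n. norm (f k) powr P) \<le> 1" for n
      using assms unfolding lp_ball_def lessThan_Suc_atMost[symmetric] by blast
  qed simp
  then show ?thesis using assms by (simp add: lp_finite)
qed

lemma sum_half_powers_le_1: "(\<Sum>j<J. (1/2::real) ^ Suc j) \<le> 1"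
proof -
  have "(\<Sum>j<J. (1/2::real) ^ Suc j) = 1 - (1/2)^J"
    by (induction J) auto
  then show ?thesis by simp
qed

text \<open>The absolute values of the coefficients are subprobability weights, so Jensen's
  inequality bounds every finite section; then \<open>J\<close> tends to infinity with
  \<open>N\<close> fixed. This closure takes the place of completeness in the gliding hump.\<close>

lemma lp_ball_sigma_convex:
  fixes F :: "nat \<Rightarrow> nat \<Rightarrow> 'a::banach"
  assumes P: "P \<ge> 1" and F: "\<And>j. F j \<in> lp_ball P" and c: "\<And>j. \<bar>c j\<bar> \<le> (1/2) ^ Suc j"
  shows "(\<lambda>n. \<Sum>j. c j *\<^sub>R F j n) \<in> lp_ball P"
proof -
  have le1: "norm (F j n) \<le> 1" for j n using lp_ball_norm_le[OF F P] .
  have sumc: "summable (\<lambda>j. norm (c j *\<^sub>R F j n))" for n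
  proof (rule summable_comparison_test'[where N = 0])
    show "summable (\<lambda>j. (1/2::real) ^ Suc j)" by (simp add: summable_geometric)
    show "norm (norm (c j *\<^sub>R F j n)) \<le> (1/2) ^ Suc j" for j
      using mult_mono[OF c[of j] le1[of j n]] by simp
  qed
  have "(\<Sum>n<N. norm (\<Sum>j. c j *\<^sub>R F j n) powr P) \<le> 1" for N
  proof -
    have part: "(\<Sum>n<N. (\<Sum>j<J. norm (c j *\<^sub>R F j n)) powr P) \<le> 1" for J
    proof -
      have sc: "(\<Sum>j<J. \<bar>c j\<bar>) \<le> 1"
        using sum_mono[of "{..<J}" "\<lambda>j. \<bar>c j\<bar>" "\<lambda>j. (1/2)^Suc j"] c sum_half_powers_le_1[of J] 
        by fastforce
      have "(\<Sum>n<N. (\<Sum>j<J. norm (c j *\<^sub>R F j n)) powr P) \<le>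
          (\<Sum>n<N. \<Sum>j<J. \<bar>c j\<bar> * norm (F j n) powr P)"
        using jensen_powr[OF P, of "{..<J}" "\<lambda>j. \<bar>c j\<bar>"] sc by (intro sum_mono) auto
      also have "\<dots> = (\<Sum>j<J. \<bar>c j\<bar> * (\<Sum>n<N. norm (F j n) powr P))"
        by (subst sum.swap) (simp add: sum_distrib_left)
      also have "\<dots> \<le> (\<Sum>j<J. \<bar>c j\<bar> * 1)"
        using F by (intro sum_mono mult_left_mono) (auto simp: lp_ball_def)
      finally show ?thesis using sc by simp
    qed
    have "(\<Sum>n<N. norm (\<Sum>j. c j *\<^sub>R F j n) powr P) \<le>
        (\<Sum>n<N. (\<Sum>j. norm (c j *\<^sub>R F j n)) powr P)"
      using P by (intro sum_mono powr_mono2 summable_norm sumc) auto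
    also have "\<dots> \<le> 1"
    proof (rule LIMSEQ_le_const2)
      show "(\<lambda>J. \<Sum>n<N. (\<Sum>j<J. norm (c j *\<^sub>R F j n)) powr P)
          \<longlonglongrightarrow> (\<Sum>n<N. (\<Sum>j. norm (c j *\<^sub>R F j n)) powr P)"
        using P
        by (intro tendsto_sum tendsto_powr2 summable_LIMSEQ sumc tendsto_const) 
           (auto intro!: always_eventually sum_nonneg)
    qed (use part in blast)
    finally show ?thesis .
  qed
  then show ?thesis by (simp add: lp_ball_def)
qed

section \<open>Uniform boundedness\<close>

text \<open>A Banach-Steinhaus theorem for seminorms, without Baire category. If it failed, a series
  with coefficients \<open>(1/4) ^ Suc k\<close> up to sign would lie in \<open>B\<close> while the
  \<open>k\<close>-th chosen seminorm of its sum is at least \<open>k/16\<close>: the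
  \<open>k\<close>-th term is nearly extremal for that seminorm, and the signs prevent cancellation
  with earlier terms.\<close>

lemma gliding_hump:
  fixes \<Phi> :: "'i \<Rightarrow> (nat \<Rightarrow> 'a::banach) \<Rightarrow> real" and B :: "(nat \<Rightarrow> 'a) set"
  assumes tri: "\<And>i f g. \<Phi> i (\<lambda>n. f n + g n) \<le> \<Phi> i f + \<Phi> i g"
    and hom: "\<And>i c f. \<Phi> i (\<lambda>n. c *\<^sub>R f n) = \<bar>c\<bar> * \<Phi> i f"
    and conv: "\<And>F c. (\<And>j. F j \<in> B) \<Longrightarrow> (\<And>j. \<bar>c j\<bar> \<le> (1/2) ^ Suc j) \<Longrightarrow>
      (\<lambda>n. \<Sum>j. c j *\<^sub>R F j n) \<in> B"
    and le1: "\<And>f n. f \<in> B \<Longrightarrow> norm (f n) \<le> 1"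
    and bdd: "\<And>i. bdd_above (\<Phi> i ` B)"
    and pw: "\<And>f. f \<in> B \<Longrightarrow> bdd_above (range (\<lambda>i. \<Phi> i f))"
  shows "\<exists>C. \<forall>i. \<forall>f\<in>B. \<Phi> i f \<le> C"
proof (rule ccontr)
  assume "\<not> ?thesis"
  then have unb: "\<exists>i. \<exists>f\<in>B. \<Phi> i f > C" for C by (meson not_le)
  define M where "M = (\<lambda>i. SUP f\<in>B. \<Phi> i f)"
  \<comment> \<open>The lower bound on \<open>M i\<close> outweighs the coefficient
    \<open>(1/4) ^ Suc k\<close>. Up to that coefficient, a hump of \<open>3/4 * M i\<close> minus a
    tail of at most \<open>1/2 * M i\<close> leaves \<open>1/4 * M i\<close>.\<close>
  have "\<exists>i f. f \<in> B \<and> M i > 4 ^ k * real k \<and> \<Phi> i f > 3/4 * M i" for k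
  proof -
    obtain i f where f: "f \<in> B" "\<Phi> i f > 4 ^ k * real k" using unb by blast
    have M: "M i > 4 ^ k * real k" 
      unfolding M_def using f bdd by (meson cSUP_upper less_le_trans)
    moreover have "4 ^ k * real k \<ge> 0" by simp
    ultimately have "0 < M i" by linarith
    then have "3/4 * M i < M i" by simp
    then obtain g where "g \<in> B" "\<Phi> i g > 3/4 * M i" 
      unfolding M_def using f less_cSUP_iff[OF _ bdd[of i], of "3/4 * Sup (\<Phi> i ` B)"] by auto
    then show ?thesis using M by blast
  qed
  then obtain I F where IF: "\<And>k. F k \<in> B" "\<And>k. M (I k) > 4 ^ k * real k"
      "\<And>k. \<Phi> (I k) (F k) > 3/4 * M (I k)"
    by metis
  define v where "v = (\<lambda>k n. (1/4) ^ Suc k *\<^sub>R F k n)"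
  \<comment> \<open>One of \<open>S + v\<close>, \<open>S - v\<close> has seminorm at least that of \<open>v\<close>, since \<open>2 v = (S + v) - (S - v)\<close>.\<close>
  define e where "e = (\<lambda>k S. if \<Phi> (I k) (\<lambda>n. S n + v k n) \<ge> \<Phi> (I k) (v k) then 1 else - 1 :: real)"
  define S where "S = rec_nat (\<lambda>_. 0) (\<lambda>k S n. S n + e k S *\<^sub>R v k n)"
  have S0: "S 0 = (\<lambda>_. 0)" and SS: "S (Suc k) = (\<lambda>n. S k n + e k (S k) *\<^sub>R v k n)" for k
    by (simp_all add: S_def)
  have big: "\<Phi> (I k) (S (Suc k)) \<ge> \<Phi> (I k) (v k)" for k
  proof (cases "\<Phi> (I k) (\<lambda>n. S k n + v k n) \<ge> \<Phi> (I k) (v k)")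
    case True
    then show ?thesis by (simp add: SS e_def)
  next
    case False
    have "2 * \<Phi> (I k) (v k) = \<Phi> (I k) (\<lambda>n. (S k n + v k n) + (-1) *\<^sub>R (S k n - v k n))"
      using hom[of "I k" 2 "v k"] by (simp add: scaleR_2)
    also have "\<dots> \<le> \<Phi> (I k) (\<lambda>n. S k n + v k n) + \<Phi> (I k) (\<lambda>n. S k n - v k n)"
      using tri[of "I k" "\<lambda>n. S k n + v k n" "\<lambda>n. (-1) *\<^sub>R (S k n - v k n)"]
        hom[of "I k" "-1" "\<lambda>n. S k n - v k n"] by simp
    finally show ?thesis using False by (simp add: SS e_def)
  qed
  define c where "c = (\<lambda>k. e k (S k) * (1/4) ^ Suc k)"
  have Ssum: "S k = (\<lambda>n. \<Sum>j<k. c j *\<^sub>R F j n)" for k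
    by (induction k) (auto simp: S0 SS c_def v_def)
  have abs_c: "\<bar>c j\<bar> = (1/4) ^ Suc j" for j by (simp add: c_def e_def abs_mult)
  define f where "f = (\<lambda>n. \<Sum>j. c j *\<^sub>R F j n)"
  have fB: "f \<in> B" unfolding f_def
    by (intro conv IF) (auto simp: abs_c intro!: power_mono simp del: power_Suc)
  have sumc: "summable (\<lambda>j. c j *\<^sub>R F j n)" for n
  proof (rule summable_comparison_test'[where N = 0])
    show "summable (\<lambda>j. (1/4::real) ^ Suc j)" by (simp add: summable_geometric)
    show "norm (c j *\<^sub>R F j n) \<le> (1/4) ^ Suc j" for j
      using mult_left_mono[OF le1[OF IF(1)[of j], of n] abs_ge_zero[of "c j"]] abs_c[of j]
      by (simp del: power_Suc)
  qed
  have lower: "\<Phi> (I k) f \<ge> real k / 16" for k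
  proof -
    \<comment> \<open>The tail coefficients have size \<open>(1/4) ^ (j + k + 2)\<close>; the
      scaling leaves \<open>2 * (1/4) ^ Suc j\<close>, at most \<open>(1/2) ^ Suc j\<close>. So the
      tail is a small multiple of an element \<open>h\<close> of \<open>B\<close>, with seminorm
      controlled by \<open>M (I k)\<close>.\<close>
    define b where "b = (\<lambda>j. c (j + Suc k) * (2 * 4 ^ Suc k))"
    define h where "h = (\<lambda>n. \<Sum>j. b j *\<^sub>R F (j + Suc k) n)"
    have "\<bar>b j\<bar> \<le> (1/2) ^ Suc j" for j
    proof -
      have "\<bar>b j\<bar> = 2 * (1/4) ^ Suc j"
        by (simp add: b_def abs_mult abs_c power_add power_divide)
      also have "\<dots> = (2 * (1/2) ^ Suc j) * (1/2) ^ Suc j"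
        by (simp add: power_divide flip: power_mult_distrib)
      also have "\<dots> \<le> 1 * (1/2) ^ Suc j"
        by (intro mult_right_mono) (auto simp: power_le_one)
      finally show ?thesis by simp
    qed
    then have hB: "h \<in> B" unfolding h_def by (intro conv IF)
    have tail: "(\<Sum>j. c (j + Suc k) *\<^sub>R F (j + Suc k) n) = (1 / (2 * 4 ^ Suc k)) *\<^sub>R h n" for n
    proof -
      have "(1 / (2 * 4 ^ Suc k)) *\<^sub>R h n = (\<Sum>j. (1 / (2 * 4 ^ Suc k)) *\<^sub>R (b j *\<^sub>R F (j + Suc k) n))"
        unfolding h_def
      proof (rule suminf_scaleR_right)
        have eq: "b j *\<^sub>R F (j + Suc k) n = (2 * 4 ^ Suc k) *\<^sub>R (c (j + Suc k) *\<^sub>R F (j + Suc k) n)" for j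
          by (simp add: b_def mult.commute)
        show "summable (\<lambda>j. b j *\<^sub>R F (j + Suc k) n)"
          unfolding eq
          by (intro summable_scaleR_right summable_ignore_initial_segment[OF sumc])
      qed
      then show ?thesis by (simp add: b_def)
    qed
    have "S (Suc k) = (\<lambda>n. f n + (- (1 / (2 * 4 ^ Suc k))) *\<^sub>R h n)"
      using suminf_split_initial_segment[OF sumc, of _ "Suc k"] unfolding Ssum f_def tail
      by (auto simp: fun_eq_iff)
    then have "\<Phi> (I k) (S (Suc k)) \<le> \<Phi> (I k) f + (1 / (2 * 4 ^ Suc k)) * \<Phi> (I k) h"
      using tri[of "I k" f "\<lambda>n. (- (1 / (2 * 4 ^ Suc k))) *\<^sub>R h n"]
        hom[of "I k" "- (1 / (2 * 4 ^ Suc k))" h] by simp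
    moreover have "\<Phi> (I k) (S (Suc k)) \<ge> (1/4) ^ Suc k * (3/4 * M (I k))"
    proof -
      have "\<Phi> (I k) (v k) = (1/4) ^ Suc k * \<Phi> (I k) (F k)"
        using hom[of "I k" "(1/4) ^ Suc k" "F k"] unfolding v_def by simp
      moreover have "(1/4) ^ Suc k * \<Phi> (I k) (F k) \<ge> (1/4) ^ Suc k * (3/4 * M (I k))"
        using IF(3)[of k] by (intro mult_left_mono) auto
      ultimately show ?thesis using big[of k] by linarith
    qed
    moreover have "\<Phi> (I k) h \<le> M (I k)"
      unfolding M_def using hB bdd by (intro cSUP_upper)
    then have "(1 / (2 * 4 ^ Suc k)) * \<Phi> (I k) h \<le> (1 / (2 * 4 ^ Suc k)) * M (I k)"
      by (intro mult_left_mono) auto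
    ultimately have "\<Phi> (I k) f \<ge> (1/4) ^ Suc k * (1/4 * M (I k))"
      by (simp add: power_divide field_simps)
    moreover have "(1/4) ^ Suc k * (1/4 * M (I k)) \<ge> (1/4) ^ Suc k * (1/4 * (4 ^ k * real k))"
      using IF(2)[of k] by (intro mult_left_mono) auto
    moreover have "(1/4) ^ Suc k * (1/4 * (4 ^ k * real k)) = real k / 16"
      by (simp add: power_divide)
    ultimately show ?thesis by linarith
  qed
  obtain C where "\<And>i. \<Phi> i f \<le> C" using pw[OF fB] by (auto simp: bdd_above_def)
  then have le: "real k / 16 \<le> C" for k using lower order_trans by blast
  obtain k where "real k > 16 * C" using reals_Archimedean2 by blast
  then show False using le[of k] by simp
qed

section \<open>The response to a forcing term\<close>

lemma solution_is_solution: "is_solution L \<tau> \<phi> f (solution L \<tau> \<phi> f)"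
  unfolding solution_def by (rule theI'[OF ex1_solution])

lemma solution_eqI: "is_solution L \<tau> \<phi> f x \<Longrightarrow> solution L \<tau> \<phi> f = x"
  unfolding solution_def by (rule the1_equality[OF ex1_solution])

locale delay_system =
  fixes L :: "nat \<Rightarrow> (nat \<Rightarrow> 'a::banach) \<Rightarrow> 'a"
  assumes bounded_delay: "bounded_delay L"
begin

abbreviation "d \<equiv> delay_order L"

definition A :: "nat \<Rightarrow> nat \<Rightarrow> 'a \<Rightarrow> 'a" where
  "A n k \<psi> = L n (coord_hist k \<psi>)"

text \<open>The input-output map for zero initial data.\<close>

definition G :: "(nat \<Rightarrow> 'a) \<Rightarrow> int \<Rightarrow> 'a" where
  "G f = solution L 0 (\<lambda>_. 0) f"

lemma L_eq: "L n \<phi> = (\<Sum>k<d. A n k (\<phi> k))"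
  unfolding A_def by (rule bounded_delay_sum[OF bounded_delay])

lemma bounded_linear_A: "bounded_linear (A n k)"
  using bounded_delay unfolding bounded_delay_def A_def by auto

lemmas A_simps = bounded_linear.linear[OF bounded_linear_A, THEN linear_add]
  bounded_linear.linear[OF bounded_linear_A, THEN linear_diff]
  bounded_linear.linear[OF bounded_linear_A, THEN linear_0]
  bounded_linear.linear[OF bounded_linear_A, THEN linear_scale]
  bounded_linear.linear[OF bounded_linear_A, THEN linear_sum]

section \<open>Linearity, causality and finite-time bounds of the response\<close>

lemma is_solution_iff:
  "is_solution L \<tau> \<phi> f x \<longleftrightarrow> (\<forall>k. x (int \<tau> - int k) = \<phi> k) \<and>
    (\<forall>n\<ge>\<tau>. x (int n + 1) = (\<Sum>k<d. A n k (x (int n - int k))) + f n)"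
  by (simp add: is_solution_def L_eq prehistory_def fun_eq_iff)

lemma solution_hist: "solution L \<tau> \<phi> f (int \<tau> - int k) = \<phi> k"
  and solution_Suc: "n \<ge> \<tau> \<Longrightarrow> solution L \<tau> \<phi> f (int n + 1) =
    (\<Sum>k<d. A n k (solution L \<tau> \<phi> f (int n - int k))) + f n"
  using solution_is_solution[of L \<tau> \<phi> f] unfolding is_solution_iff by auto

lemma G_nonpos: "t \<le> 0 \<Longrightarrow> G f t = 0"
  using solution_hist[of 0 "\<lambda>_. 0" f "nat (- t)"] by (simp add: G_def)

lemma G_Suc: "G f (int n + 1) = (\<Sum>k<d. A n k (G f (int n - int k))) + f n"
  using solution_Suc[of 0 n "\<lambda>_. 0" f] by (simp add: G_def)

lemma G_eqI:
  assumes "\<And>t. t \<le> 0 \<Longrightarrow> x t = 0"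
    and "\<And>n. x (int n + 1) = (\<Sum>k<d. A n k (x (int n - int k))) + f n"
  shows "G f = x"
  unfolding G_def by (rule solution_eqI) (use assms in \<open>auto simp: is_solution_iff\<close>)

lemma G_add: "G (\<lambda>n. f n + g n) = (\<lambda>t. G f t + G g t)"
  by (rule G_eqI) (auto simp: G_nonpos G_Suc A_simps sum.distrib)

lemma G_scaleR: "G (\<lambda>n. c *\<^sub>R f n) = (\<lambda>t. c *\<^sub>R G f t)"
  by (rule G_eqI) (auto simp: G_nonpos G_Suc A_simps scaleR_add_right scaleR_sum_right)

lemma G_zero: "G (\<lambda>n. 0) = (\<lambda>t. 0)"
  by (rule G_eqI) (auto simp: A_simps)

text \<open>Causality: the input at time \<open>n\<close> first shows at time \<open>n + 1\<close>,
  so the response still vanishes at \<open>\<tau>\<close> itself.\<close>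

lemma G_eq_0:
  assumes "\<And>n. n < \<tau> \<Longrightarrow> f n = 0" and "t \<le> int \<tau>"
  shows "G f t = 0"
proof -
  have "\<forall>t\<le>int i. G f t = 0" if "i \<le> \<tau>" for i
    using that
  proof (induction i)
    case 0
    then show ?case by (simp add: G_nonpos)
  next
    case (Suc i)
    then have "G f (int i + 1) = 0" using assms(1)[of i] by (simp add: G_Suc A_simps)
    moreover have "t \<le> int i \<or> t = int i + 1" if "t \<le> int (Suc i)" for t using that by auto
    ultimately show ?case using Suc by auto
  qed
  then show ?thesis using assms(2) by blast
qed

text \<open>A bound that may grow with \<open>n\<close>, by recursion on time; it makes each single
  window seminorm finite on the unit ball, as the gliding hump requires.\<close>

lemma G_bounded: "\<exists>c. \<forall>f. (\<forall>n. norm (f n) \<le> 1) \<longrightarrow> (\<forall>t\<le>int n. norm (G f t) \<le> c)"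
proof (induction n)
  case 0
  show ?case by (rule exI[of _ 0]) (auto simp: G_nonpos)
next
  case (Suc n)
  then obtain c where c: "\<And>f t. (\<forall>n. norm (f n) \<le> 1) \<Longrightarrow> t \<le> int n \<Longrightarrow> norm (G f t) \<le> c"
    by blast
  define c' where "c' = max c ((\<Sum>k<d. onorm (A n k) * c) + 1)"
  show ?case
  proof (intro exI[of _ c'] allI impI)
    fix f :: "nat \<Rightarrow> 'a" and t
    assume f: "\<forall>n. norm (f n) \<le> 1" and t: "t \<le> int (Suc n)"
    show "norm (G f t) \<le> c'"
    proof (cases "t \<le> int n")
      case True
      then show ?thesis using c[OF f] by (force simp: c'_def)
    next
      case False
      then have t: "t = int n + 1" using t by simp
      have "norm (G f t) \<le> (\<Sum>k<d. onorm (A n k) * c) + 1"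
        unfolding t G_Suc using f
        by (intro norm_triangle_mono sum_norm_le)
          (auto intro!: order_trans[OF onorm[OF bounded_linear_A]] mult_left_mono c f
            onorm_pos_le bounded_linear_A)
      then show ?thesis by (simp add: c'_def)
    qed
  qed
qed

text \<open>Each window \<open>(m, N)\<close> counts as one seminorm of the gliding hump, normalised
  by \<open>real N powr a\<close>; uniformity over windows and forcing terms comes at once.\<close>

lemma G_uniform_bound:
  assumes P: "P \<ge> 1"
    and pw: "\<And>f. f \<in> lp_ball P \<Longrightarrow>
      \<exists>C. \<forall>m N. (\<Sum>n\<in>{m..<m+N}. norm (G f (int n))) \<le> C * real N powr a"
  shows "\<exists>C\<ge>1. \<forall>f\<in>lp_ball P. \<forall>m N. (\<Sum>n\<in>{m..<m+N}. norm (G f (int n))) \<le> C * real N powr a"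
proof -
  define \<Phi> where "\<Phi> = (\<lambda>(m, N) f. (\<Sum>n\<in>{m..<m+N}. norm (G f (int n))) / real N powr a)"
  have "\<exists>C. \<forall>i. \<forall>f\<in>lp_ball P. \<Phi> i f \<le> C"
  proof (rule gliding_hump)
    show "\<Phi> i (\<lambda>n. f n + g n) \<le> \<Phi> i f + \<Phi> i g" for i f g
      by (auto simp: \<Phi>_def split_beta G_add simp flip: add_divide_distrib sum.distrib
          intro!: divide_right_mono sum_mono norm_triangle_ineq)
    show "\<Phi> i (\<lambda>n. c *\<^sub>R f n) = \<bar>c\<bar> * \<Phi> i f" for i c f
      by (auto simp: \<Phi>_def split_beta G_scaleR sum_distrib_left)
    show "(\<lambda>n. \<Sum>j. c j *\<^sub>R F j n) \<in> lp_ball P"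
      if "\<And>j. F j \<in> lp_ball P" "\<And>j. \<bar>c j\<bar> \<le> (1/2) ^ Suc j"
      for F :: "nat \<Rightarrow> nat \<Rightarrow> 'a" and c
      using that by (rule lp_ball_sigma_convex[OF P])
    show "norm (f n) \<le> 1" if "f \<in> lp_ball P" for f n using lp_ball_norm_le[OF that P] .
    show "bdd_above (\<Phi> i ` lp_ball P)" for i
    proof (cases i)
      case (Pair m N)
      obtain c where c: "\<And>f t. (\<forall>n. norm (f n) \<le> 1) \<Longrightarrow> t \<le> int (m + N) \<Longrightarrow> norm (G f t) \<le> c"
        using G_bounded by blast
      have "\<Phi> i f \<le> (\<Sum>n\<in>{m..<m+N}. c) / real N powr a" if "f \<in> lp_ball P" for f
        unfolding \<Phi>_def Pair prod.case using that
        by (intro divide_right_mono sum_mono c) (auto intro: lp_ball_norm_le[OF _ P])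
      then show ?thesis by (auto simp: bdd_above_def)
    qed
    show "bdd_above (range (\<lambda>i. \<Phi> i f))" if "f \<in> lp_ball P" for f
    proof -
      obtain C where C: "\<And>m N. (\<Sum>n\<in>{m..<m+N}. norm (G f (int n))) \<le> C * real N powr a"
        using pw \<open>f \<in> lp_ball P\<close> by blast
      have "\<Phi> (m, N) f \<le> max C 0" for m N
        using C[of m N] by (cases "N = 0") (auto simp: \<Phi>_def field_simps le_max_iff_disj)
      then show ?thesis by (auto simp: bdd_above_def)
    qed
  qed
  then obtain C where C: "\<And>i f. f \<in> lp_ball P \<Longrightarrow> \<Phi> i f \<le> C" by blast
  show ?thesis
  proof (intro exI[of _ "max 1 C"] conjI ballI allI)
    fix f :: "nat \<Rightarrow> 'a" and m N assume f: "f \<in> lp_ball P"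
    show "(\<Sum>n\<in>{m..<m+N}. norm (G f (int n))) \<le> max 1 C * real N powr a"
    proof (cases "N = 0")
      case False
      then have "(\<Sum>n\<in>{m..<m+N}. norm (G f (int n))) \<le> C * real N powr a"
        using C[OF f, of "(m, N)"] by (simp add: \<Phi>_def field_simps)
      also have "\<dots> \<le> max 1 C * real N powr a" by (intro mult_right_mono) auto
      finally show ?thesis .
    qed simp
  qed simp
qed

end

text \<open>\<open>G_window\<close> is the only consequence of stability that the converse uses: for an output in
  the space of \<open>q\<close>-summable sequences, Jensen's inequality gives it with \<open>a = 1 - 1/q\<close>.\<close>

locale stable_delay_system = delay_system +
  fixes P a C :: real
  assumes P: "P \<ge> 1" and a: "0 \<le> a" and C: "C \<ge> 1"
    and G_window: "f \<in> lp_ball P \<Longrightarrow> (\<Sum>n\<in>{m..<m+N}. norm (G f (int n))) \<le> C * real N powr a"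
begin

section \<open>Response bounds by homogeneity, and uniform bounds on the coefficients\<close>

lemma G_window_scaled:
  assumes c: "c \<ge> 0" and f: "\<And>N. (\<Sum>n<N. norm (f n) powr P) \<le> c powr P"
  shows "(\<Sum>n\<in>{m..<m+N}. norm (G f (int n))) \<le> C * c * real N powr a"
proof (cases "c = 0")
  case True
  \<comment> \<open>Normalising by \<open>1/c\<close> is impossible for \<open>c = 0\<close>, but
    then every partial sum is at most \<open>0 powr P = 0\<close> and the forcing vanishes.\<close>
  have "f n = 0" for n
  proof -
    have "norm (f n) powr P \<le> (\<Sum>n<Suc n. norm (f n) powr P)"
      by (rule member_le_sum) auto
    from order_trans[OF this f] have "norm (f n) powr P \<le> 0" using True by simp
    then show ?thesis by (metis norm_eq_zero powr_eq_0_iff powr_ge_zero order_antisym)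
  qed
  then have "f = (\<lambda>n. 0)" by auto
  then show ?thesis using True by (simp add: G_zero)
next
  case False
  then have c: "c > 0" using c by simp
  have "(\<Sum>n<N. norm ((1/c) *\<^sub>R f n) powr P) = (\<Sum>n<N. norm (f n) powr P) / c powr P" for N
    using c by (simp add: powr_divide sum_divide_distrib)
  also have "\<dots> N \<le> 1" for N using f[of N] c by (simp add: divide_le_eq)
  finally have "(\<lambda>n. (1/c) *\<^sub>R f n) \<in> lp_ball P" by (simp add: lp_ball_def)
  from G_window[OF this, of m N] c show ?thesis
    by (simp add: G_scaleR field_simps flip: sum_divide_distrib)
qed

lemma G_norm_scaled:
  assumes "c \<ge> 0" and "\<And>N. (\<Sum>n<N. norm (f n) powr P) \<le> c powr P"
  shows "norm (G f (int n)) \<le> C * c"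
  using G_window_scaled[OF assms, of n 1] by simp

lemma powr_sum_finite_support:
  fixes f :: "nat \<Rightarrow> 'a"
  assumes f0: "\<And>n. n \<notin> {\<tau>..<\<tau>+W} \<Longrightarrow> f n = 0" and fc: "\<And>n. norm (f n) \<le> c"
  shows "(\<Sum>n<N. norm (f n) powr P) \<le> (real W powr (1/P) * c) powr P"
proof -
  have c: "c \<ge> 0" using fc norm_ge_zero order_trans by blast
  have "(\<Sum>n<N. norm (f n) powr P) = (\<Sum>n\<in>{..<N} \<inter> {\<tau>..<\<tau>+W}. norm (f n) powr P)"
    by (rule sum.mono_neutral_right) (use f0 in auto)
  also have "\<dots> \<le> (\<Sum>n\<in>{\<tau>..<\<tau>+W}. norm (f n) powr P)"
    by (rule sum_mono2) auto
  also have "\<dots> \<le> (\<Sum>n\<in>{\<tau>..<\<tau>+W}. c powr P)"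
    using fc P by (intro sum_mono powr_mono2) auto
  also have "\<dots> = (real W powr (1/P) * c) powr P"
    using c P by (simp add: powr_mult powr_powr)
  finally show ?thesis .
qed

text \<open>Induction on the lag \<open>j\<close>. An impulse timed to be read with lag exactly
  \<open>j\<close> at time \<open>n\<close> isolates \<open>A n j \<psi>\<close>: longer lags still
  read zeros, and shorter lags are bounded by the induction hypothesis and the bound on the
  response.\<close>

lemma A_bounded: "\<exists>M\<ge>0. \<forall>n k \<psi>. k < d \<longrightarrow> norm (A n k \<psi>) \<le> M * norm \<psi>"
proof -
  have ex: "\<exists>M. \<forall>n \<psi>. norm (A n j \<psi>) \<le> M * norm \<psi>" if "j < d" for j
    using that
  proof (induction j rule: less_induct)
    case (less j)
    then have "\<forall>k. \<exists>M. k < j \<longrightarrow> (\<forall>n \<psi>. norm (A n k \<psi>) \<le> M * norm \<psi>)" by force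
    then obtain M where M: "\<And>k n \<psi>. k < j \<Longrightarrow> norm (A n k \<psi>) \<le> M k * norm \<psi>"
      by metis
    define B where "B = C + (\<Sum>k<j. \<bar>M k\<bar> * C)"
    have B0: "B \<ge> 0" using C by (auto simp: B_def intro!: add_nonneg_nonneg sum_nonneg)
    have big: "norm (A n j \<psi>) \<le> B * norm \<psi>" if "n \<ge> j + 1" for n \<psi>
    proof -
      \<comment> \<open>The response equals \<open>\<psi>\<close> one step after the impulse, at
        \<open>\<tau> + 1 = n - j\<close>.\<close>
      define \<tau> where "\<tau> = n - 1 - j"
      have n: "n = \<tau> + 1 + j" using that by (simp add: \<tau>_def)
      define f where "f = (\<lambda>i. if i = \<tau> then \<psi> else 0)"
      have "(\<Sum>n<N. norm (f n) powr P) \<le> (real 1 powr (1/P) * norm \<psi>) powr P" for N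
        by (rule powr_sum_finite_support[of \<tau>]) (auto simp: f_def)
      then have Gb: "norm (G f (int i)) \<le> C * norm \<psi>" for i
        by (intro G_norm_scaled) auto
      have G0: "G f t = 0" if "t \<le> int \<tau>" for t
        by (rule G_eq_0[OF _ that]) (simp add: f_def)
      have G1: "G f (int \<tau> + 1) = \<psi>"
      proof -
        have "f \<tau> = \<psi>" by (simp add: f_def)
        then show ?thesis by (simp add: G_Suc G0 A_simps)
      qed
      have "(\<Sum>k<d. A n k (G f (int n - int k))) = (\<Sum>k<Suc j. A n k (G f (int n - int k)))"
      proof (rule sum.mono_neutral_right)
        show "\<forall>k\<in>{..<d} - {..<Suc j}. A n k (G f (int n - int k)) = 0"
        proof
          fix k assume "k \<in> {..<d} - {..<Suc j}"
          then have "G f (int n - int k) = 0" using n by (intro G0) auto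
          then show "A n k (G f (int n - int k)) = 0" by (simp add: A_simps)
        qed
      qed (use less.prems in auto)
      also have "\<dots> = (\<Sum>k<j. A n k (G f (int n - int k))) + A n j \<psi>"
      proof -
        have "int n - int j = int \<tau> + 1" using n by simp
        then show ?thesis using G1 by simp
      qed
      moreover have "f n = 0" using n by (simp add: f_def)
      ultimately have "A n j \<psi> = G f (int n + 1) - (\<Sum>k<j. A n k (G f (int n - int k)))"
        using G_Suc[of f n] by simp
      also have "norm \<dots> \<le> C * norm \<psi> + (\<Sum>k<j. \<bar>M k\<bar> * (C * norm \<psi>))"
      proof (rule order_trans[OF norm_triangle_ineq4], intro add_mono sum_norm_le)
        show "norm (G f (int n + 1)) \<le> C * norm \<psi>" using Gb[of "Suc n"] by (simp add: add.commute)
        fix k assume k: "k \<in> {..<j}"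
        then have "int n - int k = int (n - k)" using n by simp
        then have g: "norm (G f (int n - int k)) \<le> C * norm \<psi>" using Gb by metis
        have "norm (A n k (G f (int n - int k))) \<le> M k * norm (G f (int n - int k))"
          using M k by simp
        also have "\<dots> \<le> \<bar>M k\<bar> * (C * norm \<psi>)" using g by (intro mult_mono) auto
        finally show "norm (A n k (G f (int n - int k))) \<le> \<bar>M k\<bar> * (C * norm \<psi>)" .
      qed
      also have "\<dots> = B * norm \<psi>" by (simp add: B_def algebra_simps sum_distrib_left)
      finally show ?thesis .
    qed
    \<comment> \<open>The finitely many times \<open>n \<le> j\<close>, too early for such an
      impulse, are covered by adding their operator norms.\<close>
    define B' where "B' = B + (\<Sum>n\<le>j. onorm (A n j))"
    have "norm (A n j \<psi>) \<le> B' * norm \<psi>" for n \<psi>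
    proof (cases "n \<le> j")
      case True
      have "norm (A n j \<psi>) \<le> onorm (A n j) * norm \<psi>" by (rule onorm[OF bounded_linear_A])
      also have "onorm (A n j) \<le> (\<Sum>n\<le>j. onorm (A n j))"
        by (rule member_le_sum) (use True in \<open>auto intro: onorm_pos_le bounded_linear_A\<close>)
      also have "\<dots> \<le> B'" using B0 by (simp add: B'_def)
      finally show ?thesis by (simp add: mult_right_mono)
    next
      case False
      then have "norm (A n j \<psi>) \<le> B * norm \<psi>" using big by simp
      also have "B \<le> B'" by (auto simp: B'_def intro!: sum_nonneg onorm_pos_le bounded_linear_A)
      finally show ?thesis by (simp add: mult_right_mono)
    qed
    then show ?case by blast
  qed
  then obtain M where M: "\<And>j n \<psi>. j < d \<Longrightarrow> norm (A n j \<psi>) \<le> M j * norm \<psi>" by metis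
  show ?thesis
  proof (intro exI[of _ "\<Sum>j<d. \<bar>M j\<bar>"] conjI allI impI)
    fix n k \<psi> assume k: "k < d"
    have "norm (A n k \<psi>) \<le> M k * norm \<psi>" using M k by simp
    also have "M k \<le> \<bar>M k\<bar>" by simp
    also have "\<bar>M k\<bar> \<le> (\<Sum>j<d. \<bar>M j\<bar>)" by (rule member_le_sum) (use k in auto)
    finally show "norm (A n k \<psi>) \<le> (\<Sum>j<d. \<bar>M j\<bar>) * norm \<psi>" by (simp add: mult_right_mono)
  qed (simp add: sum_nonneg)
qed

end

section \<open>Decay of homogeneous solutions\<close>

lemma powr_le_half:
  fixes K a :: real
  assumes "a < 1"
  shows "\<exists>N\<ge>N0. K * real N powr a \<le> real N / 2"
proof -
  have "filterlim (\<lambda>N. real N powr (1 - a)) at_top sequentially"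
    using assms by real_asymp
  then have "eventually (\<lambda>N. real N powr (1 - a) \<ge> 2 * K) sequentially"
    by (simp add: filterlim_at_top)
  then have "eventually (\<lambda>N. real N powr (1 - a) \<ge> 2 * K \<and> N \<ge> max N0 1) sequentially"
    using eventually_ge_at_top eventually_conj by blast
  then obtain N where N: "real N powr (1 - a) \<ge> 2 * K" "N \<ge> max N0 1"
    using eventually_happens' sequentially_bot by blast
  have "2 * K * real N powr a \<le> real N powr (1 - a) * real N powr a"
    using N by (intro mult_right_mono) auto
  also have "\<dots> = real N" using N by (simp flip: powr_add)
  finally show ?thesis using N by (intro exI[of _ N]) auto
qed

context stable_delay_system
begin

text \<open>The bound \<open>R\<close> concerns only the \<open>d\<close> values that the recursion
  reads. This is independent of any phase space and can be renewed at later times. For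
  \<open>d = 0\<close> the last conjunct is vacuous, hence the explicit
  \<open>R \<ge> 0\<close>.\<close>

definition homogeneous :: "nat \<Rightarrow> (int \<Rightarrow> 'a) \<Rightarrow> real \<Rightarrow> bool" where
  "homogeneous \<tau> x R \<longleftrightarrow>
     (\<forall>n\<ge>\<tau>. x (int n + 1) = (\<Sum>k<d. A n k (x (int n - int k)))) \<and>
     R \<ge> 0 \<and> (\<forall>k<d. norm (x (int \<tau> - int k)) \<le> R)"

lemma homogeneous_restart:
  assumes "homogeneous \<tau> x R" "\<tau>' \<ge> \<tau>" "R' \<ge> 0" "\<And>k. k < d \<Longrightarrow> norm (x (int \<tau>' - int k)) \<le> R'"
  shows "homogeneous \<tau>' x R'"
  using assms unfolding homogeneous_def by auto

text \<open>The part \<open>z\<close> of the solution after \<open>\<tau>\<close> has zero history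
  and is the response to the forcing \<open>g\<close> that the cut-off part \<open>u\<close> feeds
  into the recursion, so both bounds of the response carry over.\<close>

lemma homogeneous_bounded:
  "\<exists>C1\<ge>1. \<forall>\<tau> x R. homogeneous \<tau> x R \<longrightarrow>
     (\<forall>n>\<tau>. norm (x (int n)) \<le> C1 * R) \<and>
     (\<forall>N. (\<Sum>n\<in>{\<tau><..\<tau>+N}. norm (x (int n))) \<le> C1 * R * real N powr a)"
proof -
  obtain M where M0: "M \<ge> 0" and M: "\<And>n k \<psi>. k < d \<Longrightarrow> norm (A n k \<psi>) \<le> M * norm \<psi>"
    using A_bounded by blast
  \<comment> \<open>Forcing at \<open>d\<close> points, each value at most \<open>d * M * R\<close>,
    has \<open>P\<close>-norm at most \<open>d powr (1/P)\<close> times that; \<open>C\<close> is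
    the gain of the response.\<close>
  define C0 where "C0 = C * (real d powr (1/P) * (real d * M))"
  show ?thesis
  proof (intro exI[of _ "max 1 C0"] conjI allI impI)
    fix \<tau> x R assume "homogeneous \<tau> x R"
    then have rec: "\<And>n. n \<ge> \<tau> \<Longrightarrow> x (int n + 1) = (\<Sum>k<d. A n k (x (int n - int k)))"
      and R: "R \<ge> 0" and hist: "\<And>k. k < d \<Longrightarrow> norm (x (int \<tau> - int k)) \<le> R"
      unfolding homogeneous_def by auto
    define z where "z = (\<lambda>t. if t > int \<tau> then x t else 0)"
    define u where "u = (\<lambda>t. if t > int \<tau> then 0 else x t)"
    define g where "g = (\<lambda>n. if n \<ge> \<tau> then \<Sum>k<d. A n k (u (int n - int k)) else 0)"
    have Gz: "G g = z"
    proof (rule G_eqI)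
      fix n
      have split: "A n k (x (int n - int k)) = A n k (z (int n - int k)) + A n k (u (int n - int k))" for k
        by (simp add: z_def u_def A_simps)
      have "z (int n + 1) = (\<Sum>k<d. A n k (z (int n - int k))) + g n" if "n \<ge> \<tau>"
      proof -
        have "z (int n + 1) = (\<Sum>k<d. A n k (x (int n - int k)))"
          using that rec[OF that] by (simp add: z_def)
        then show ?thesis using that by (simp add: split sum.distrib g_def)
      qed
      moreover have "z (int n + 1) = (\<Sum>k<d. A n k (z (int n - int k))) + g n" if "n < \<tau>"
        using that by (simp add: z_def g_def A_simps)
      ultimately show "z (int n + 1) = (\<Sum>k<d. A n k (z (int n - int k))) + g n"
        by (meson not_le)
    qed (simp add: z_def)
    \<comment> \<open>From \<open>n = \<tau> + d\<close> on, every \<open>n - k\<close> with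
      \<open>k < d\<close> exceeds \<open>\<tau>\<close>, where \<open>u\<close> vanishes.\<close>
    have gsupp: "g n = 0" if "n \<notin> {\<tau>..<\<tau>+d}" for n
      using that by (auto simp: g_def u_def A_simps intro!: sum.neutral)
    have gb: "norm (g n) \<le> real d * M * R" for n
    proof (cases "n \<ge> \<tau>")
      case True
      have "norm (u (int n - int k)) \<le> R" if "k < d" for k
      proof (cases "int n - int k \<le> int \<tau>")
        case le: True
        then have "int n - int k = int \<tau> - int (k - (n - \<tau>))" using True by auto
        moreover have "k - (n - \<tau>) < d" using that by simp
        ultimately have "norm (x (int n - int k)) \<le> R" using hist by metis
        then show ?thesis using le by (simp add: u_def)
      qed (simp add: u_def R)
      then have "norm (A n k (u (int n - int k))) \<le> M * R" if "k < d" for k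
        using that M0 by (blast intro: order_trans[OF M] mult_left_mono)
      then have "norm (\<Sum>k<d. A n k (u (int n - int k))) \<le> (\<Sum>k<d. M * R)"
        by (intro sum_norm_le) simp
      then show ?thesis using True by (simp add: g_def)
    next
      case False
      then show ?thesis using M0 R by (simp add: g_def)
    qed
    define c where "c = real d powr (1/P) * (real d * M * R)"
    have c0: "c \<ge> 0" using M0 R by (simp add: c_def)
    have gp: "(\<Sum>n<N. norm (g n) powr P) \<le> c powr P" for N
      unfolding c_def by (rule powr_sum_finite_support[OF gsupp gb])
    have Cc: "C * c = C0 * R" by (simp add: c_def C0_def)
    have le: "C0 * R \<le> max 1 C0 * R" using R by (intro mult_right_mono) auto
    show "norm (x (int n)) \<le> max 1 C0 * R" if "n > \<tau>" for n
      using G_norm_scaled[OF c0 gp, of n] that le Cc by (simp add: Gz z_def)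
    show "(\<Sum>n\<in>{\<tau><..\<tau>+N}. norm (x (int n))) \<le> max 1 C0 * R * real N powr a" for N
    proof -
      have "(\<Sum>n\<in>{\<tau><..\<tau>+N}. norm (x (int n))) = (\<Sum>n\<in>{Suc \<tau>..<Suc \<tau>+N}. norm (z (int n)))"
        by (rule sum.cong) (auto simp: z_def)
      also have "\<dots> \<le> C0 * R * real N powr a"
        using G_window_scaled[OF c0 gp, of "Suc \<tau>" N] unfolding Gz Cc .
      also have "\<dots> \<le> max 1 C0 * R * real N powr a" by (rule mult_right_mono[OF le]) simp
      finally show ?thesis .
    qed
  qed simp
qed

text \<open>Multiplying a solution by a ramp of length \<open>N\<close> gives a solution with a forcing term of
  size independent of \<open>N\<close>, supported on \<open>N + d\<close> points; for \<open>P > 1\<close> its norm is \<open>o(N)\<close>,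
  while the solution equals \<open>N x\<close> after the ramp.\<close>

lemma homogeneous_small_ramp:
  assumes P1: "P > 1"
  shows "\<exists>K. \<forall>\<tau> x R N n. homogeneous \<tau> x R \<and> N \<ge> d \<and> n \<ge> \<tau> + N \<and> n > \<tau> \<longrightarrow>
    real N * norm (x (int n)) \<le> K * R * real N powr (1/P)"
proof -
  obtain M where M0: "M \<ge> 0" and M: "\<And>n k \<psi>. k < d \<Longrightarrow> norm (A n k \<psi>) \<le> M * norm \<psi>"
    using A_bounded by blast
  obtain C1 where C1: "C1 \<ge> 1" and bd: "\<And>\<tau> x R n. homogeneous \<tau> x R \<Longrightarrow> n > \<tau> \<Longrightarrow>
      norm (x (int n)) \<le> C1 * R"
    using homogeneous_bounded by blast
  \<comment> \<open>One factor \<open>d\<close> counts the lags, the other bounds the increment of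
    the ramp over at most \<open>d\<close> steps.\<close>
  define D where "D = real d * M * real d * C1"
  have D0: "D \<ge> 0" using M0 C1 by (simp add: D_def)
  show ?thesis
  proof (intro exI[of _ "C * 2 powr (1/P) * D"] allI impI, elim conjE)
    fix \<tau> x R N n
    assume hom: "homogeneous \<tau> x R" and Nd: "N \<ge> d" and n: "n \<ge> \<tau> + N" "n > \<tau>"
    then have rec: "\<And>n. n \<ge> \<tau> \<Longrightarrow> x (int n + 1) = (\<Sum>k<d. A n k (x (int n - int k)))"
      and R: "R \<ge> 0" and hist: "\<And>k. k < d \<Longrightarrow> norm (x (int \<tau> - int k)) \<le> R"
      unfolding homogeneous_def by auto
    define r where "r = (\<lambda>t::int. min (real N) (max 0 (real_of_int (t - int \<tau>))))"
    \<comment> \<open>The commutator of ramp and recursion: \<open>r (n + 1)\<close> times the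
      right-hand side at \<open>x\<close>, minus the right-hand side at \<open>r x\<close>. Only
      increments of \<open>r\<close> enter, so its size does not grow with \<open>N\<close>.\<close>
    define f where "f = (\<lambda>n. if n \<ge> \<tau> then
      \<Sum>k<d. A n k ((r (int n + 1) - r (int n - int k)) *\<^sub>R x (int n - int k)) else 0)"
    have Gf: "G f = (\<lambda>t. r t *\<^sub>R x t)"
    proof (rule G_eqI)
      fix n
      have "r (int n + 1) *\<^sub>R x (int n + 1)
        = (\<Sum>k<d. A n k (r (int n - int k) *\<^sub>R x (int n - int k))) + f n" if "n \<ge> \<tau>"
        using that
        by (simp add: rec f_def A_simps scaleR_sum_right scaleR_diff_left flip: sum.distrib)
      moreover have "r (int n + 1) *\<^sub>R x (int n + 1)
        = (\<Sum>k<d. A n k (r (int n - int k) *\<^sub>R x (int n - int k))) + f n" if "n < \<tau>"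
        using that by (simp add: r_def f_def A_simps)
      ultimately show "r (int n + 1) *\<^sub>R x (int n + 1)
        = (\<Sum>k<d. A n k (r (int n - int k) *\<^sub>R x (int n - int k))) + f n" by (meson not_le)
    qed (simp add: r_def)
    have fsupp: "f n = 0" if "n \<notin> {\<tau>..<\<tau>+(N+d)}" for n
      using that by (auto simp: f_def r_def A_simps intro!: sum.neutral)
    have fb: "norm (f n) \<le> D * R" for n
    proof (cases "n \<ge> \<tau>")
      case True
      have xb: "norm (x (int n - int k)) \<le> C1 * R" if "k < d" for k
      proof (cases "int n - int k \<le> int \<tau>")
        case le: True
        then have "int n - int k = int \<tau> - int (k - (n - \<tau>))" using True by auto
        moreover have "k - (n - \<tau>) < d" using that by simp
        ultimately have "norm (x (int n - int k)) \<le> R" using hist by metis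
        also have "R \<le> C1 * R" using C1 R by (simp add: mult_le_cancel_right1)
        finally show ?thesis .
      next
        case False
        then have "int n - int k = int (n - k)" "n - k > \<tau>" by auto
        then show ?thesis using bd[OF hom] by metis
      qed
      have "norm (A n k ((r (int n + 1) - r (int n - int k)) *\<^sub>R x (int n - int k)))
          \<le> M * (real d * (C1 * R))" if "k < d" for k
      proof (rule order_trans[OF M[OF that]], intro mult_left_mono M0)
        have "\<bar>r (int n + 1) - r (int n - int k)\<bar> \<le> real d" using that by (auto simp: r_def)
        then show "norm ((r (int n + 1) - r (int n - int k)) *\<^sub>R x (int n - int k)) \<le> real d * (C1 * R)"
          unfolding norm_scaleR using xb[OF that] by (intro mult_mono) auto
      qed
      then have "norm (\<Sum>k<d. A n k ((r (int n + 1) - r (int n - int k)) *\<^sub>R x (int n - int k)))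
          \<le> (\<Sum>k<d. M * (real d * (C1 * R)))"
        by (intro sum_norm_le) simp
      then show ?thesis using True by (simp add: f_def D_def mult_ac)
    next
      case False
      then show ?thesis using D0 R by (simp add: f_def)
    qed
    have "r (int n) = real N" using n by (simp add: r_def)
    then have "real N * norm (x (int n)) = norm (G f (int n))" by (simp add: Gf)
    also have "\<dots> \<le> C * (real (N + d) powr (1/P) * (D * R))"
      using D0 R by (intro G_norm_scaled powr_sum_finite_support[OF fsupp fb]) auto
    \<comment> \<open>Here \<open>N \<ge> d\<close> gives \<open>N + d \<le> 2 * N\<close>, which
      keeps the constant independent of \<open>N\<close>.\<close>
    also have "\<dots> \<le> C * ((2 * real N) powr (1/P) * (D * R))"
      using C D0 R Nd P by (intro mult_left_mono mult_right_mono powr_mono2) auto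
    also have "\<dots> = C * 2 powr (1/P) * D * R * real N powr (1/P)"
      by (simp add: powr_mult)
    finally show "real N * norm (x (int n)) \<le> C * 2 powr (1/P) * D * R * real N powr (1/P)" .
  qed
qed

text \<open>The value at \<open>n\<close> is controlled by the prehistory at each of the \<open>N\<close> times before \<open>n\<close>, hence
  by their average.\<close>

lemma homogeneous_small_window:
  assumes a1: "a < 1"
  shows "\<exists>K. \<forall>\<tau> x R N n. homogeneous \<tau> x R \<and> N \<ge> 1 \<and> n \<ge> \<tau> + N \<longrightarrow>
    real N * norm (x (int n)) \<le> K * R * real N powr a"
proof -
  obtain C1 where C1: "C1 \<ge> 1" and bd: "\<And>\<tau> x R n. homogeneous \<tau> x R \<Longrightarrow> n > \<tau> \<Longrightarrow>
      norm (x (int n)) \<le> C1 * R"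
    and win: "\<And>\<tau> x R N. homogeneous \<tau> x R \<Longrightarrow>
      (\<Sum>n\<in>{\<tau><..\<tau>+N}. norm (x (int n))) \<le> C1 * R * real N powr a"
    using homogeneous_bounded by blast
  show ?thesis
  \<comment> \<open>The outer \<open>C1\<close> carries the solution from \<open>\<tau> + i\<close>
    to \<open>n\<close>, \<open>d\<close> counts the lags, and \<open>d + C1\<close> bounds each
    lagged window sum.\<close>
  proof (intro exI[of _ "C1 * (real d * (real d + C1))"] allI impI, elim conjE)
    fix \<tau> x R N n
    assume hom: "homogeneous \<tau> x R" and N: "N \<ge> 1" and n: "n \<ge> \<tau> + N"
    then have R: "R \<ge> 0" and hist: "\<And>k. k < d \<Longrightarrow> norm (x (int \<tau> - int k)) \<le> R"
      unfolding homogeneous_def by auto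
    have Na: "real N powr a \<ge> 1" using N a by (intro ge_one_powr_ge_zero) auto
    \<comment> \<open>Indices \<open>i \<le> k\<close>, at most \<open>d\<close> of them, read the
      prehistory and contribute \<open>R\<close> each; the others fall into the window after
      \<open>\<tau>\<close>. Since \<open>N powr a \<ge> 1\<close>, the contribution
      \<open>d * R\<close> is absorbed.\<close>
    have shift: "(\<Sum>i<N. norm (x (int (\<tau> + i) - int k))) \<le> (real d + C1) * R * real N powr a"
      if k: "k < d" for k
    proof -
      have "(\<Sum>i<N. norm (x (int (\<tau> + i) - int k))) \<le>
          (\<Sum>i<N. (if i \<le> k then R else 0) + (if i > k then norm (x (int (\<tau> + i - k))) else 0))"
      proof (rule sum_mono)
        fix i
        have "norm (x (int (\<tau> + i) - int k)) \<le> R" if "i \<le> k"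
        proof -
          have "int (\<tau> + i) - int k = int \<tau> - int (k - i)" using that by simp
          then show ?thesis using hist[of "k - i"] k by (simp only:)
        qed
        moreover have "int (\<tau> + i) - int k = int (\<tau> + i - k)" if "i > k" using that by simp
        ultimately show "norm (x (int (\<tau> + i) - int k)) \<le>
            (if i \<le> k then R else 0) + (if i > k then norm (x (int (\<tau> + i - k))) else 0)" by auto
      qed
      also have "\<dots> = (\<Sum>i<N. if i \<le> k then R else 0) +
          (\<Sum>i<N. if i > k then norm (x (int (\<tau> + i - k))) else 0)"
        by (rule sum.distrib)
      also have "(\<Sum>i<N. if i \<le> k then R else 0) \<le> real d * R"
      proof -
        have "(\<Sum>i<N. if i \<le> k then R else 0) = real (card {i. i < N \<and> i \<le> k}) * R"
          by (simp add: sum.If_cases Int_def)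
        also have "card {i. i < N \<and> i \<le> k} \<le> d"
          using k card_mono[of "{..<d}" "{i. i < N \<and> i \<le> k}"] by fastforce
        finally show ?thesis using R by (simp add: mult_right_mono)
      qed
      also have "(\<Sum>i<N. if i > k then norm (x (int (\<tau> + i - k))) else 0) \<le> C1 * R * real N powr a"
      proof -
        have "(\<Sum>i<N. if i > k then norm (x (int (\<tau> + i - k))) else 0) =
            (\<Sum>i\<in>{i. i < N \<and> k < i}. norm (x (int (\<tau> + i - k))))"
          by (simp add: sum.If_cases Int_def)
        also have "\<dots> = (\<Sum>m\<in>(\<lambda>i. \<tau> + i - k) ` {i. i < N \<and> k < i}. norm (x (int m)))"
          by (subst sum.reindex) (auto simp: inj_on_def)
        also have "\<dots> \<le> (\<Sum>m\<in>{\<tau><..\<tau>+N}. norm (x (int m)))"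
          by (rule sum_mono2) auto
        also have "\<dots> \<le> C1 * R * real N powr a" by (rule win[OF hom])
        finally show ?thesis .
      qed
      also have "real d * R + C1 * R * real N powr a \<le> (real d + C1) * R * real N powr a"
        using mult_left_mono[OF Na, of "real d * R"] R by (simp add: algebra_simps)
      finally show ?thesis by simp
    qed
    have "real N * norm (x (int n)) = (\<Sum>i<N. norm (x (int n)))" by simp
    also have "\<dots> \<le> (\<Sum>i<N. C1 * (\<Sum>k<d. norm (x (int (\<tau> + i) - int k))))"
    proof (rule sum_mono)
      fix i assume i: "i \<in> {..<N}"
      show "norm (x (int n)) \<le> C1 * (\<Sum>k<d. norm (x (int (\<tau> + i) - int k)))"
      proof (rule bd)
        \<comment> \<open>The sum of the last \<open>d\<close> norms serves as history bound: summed
          over \<open>i\<close> and with the sums exchanged, it becomes a sum of lagged window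
          sums.\<close>
        show "homogeneous (\<tau> + i) x (\<Sum>k<d. norm (x (int (\<tau> + i) - int k)))"
          by (rule homogeneous_restart[OF hom])
            (auto intro!: sum_nonneg member_le_sum[of _ _ "\<lambda>k. norm (x (int \<tau> + int i - int k))"])
      qed (use i n in auto)
    qed
    also have "\<dots> = C1 * (\<Sum>k<d. \<Sum>i<N. norm (x (int (\<tau> + i) - int k)))"
      by (subst sum.swap) (simp add: sum_distrib_left)
    also have "\<dots> \<le> C1 * (\<Sum>k<d. (real d + C1) * R * real N powr a)"
      using C1 shift by (intro mult_left_mono sum_mono) auto
    also have "\<dots> = C1 * (real d * (real d + C1)) * R * real N powr a" by simp
    finally show "real N * norm (x (int n)) \<le> C1 * (real d * (real d + C1)) * R * real N powr a" .
  qed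
qed

text \<open>Both mechanisms bound \<open>N * norm (x n)\<close> by \<open>K * R * N powr b\<close>
  with \<open>b < 1\<close>: \<open>b = 1/P\<close> from the ramp, \<open>b = a\<close> from
  averaging. A fixed large \<open>N\<close> then gives the factor one half.\<close>

lemma homogeneous_half:
  assumes "P > 1 \<or> a < 1"
  shows "\<exists>N\<ge>1. \<forall>\<tau> x R n. homogeneous \<tau> x R \<and> n \<ge> \<tau> + N \<longrightarrow> norm (x (int n)) \<le> R / 2"
proof -
  obtain K b where b: "b < 1" and K: "\<And>\<tau> x R N n. homogeneous \<tau> x R \<Longrightarrow> N \<ge> max d 1 \<Longrightarrow>
      n \<ge> \<tau> + N \<Longrightarrow> real N * norm (x (int n)) \<le> K * R * real N powr b"
  proof (cases "P > 1")
    case True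
    then show ?thesis using homogeneous_small_ramp[OF True] that[of "1/P"] by fastforce
  next
    case False
    then have "a < 1" using assms by simp
    from homogeneous_small_window[OF this] that[OF this] show ?thesis by fastforce
  qed
  obtain N where N: "N \<ge> max d 1" "K * real N powr b \<le> real N / 2"
    using powr_le_half[OF b] by blast
  have "norm (x (int n)) \<le> R / 2" if hom: "homogeneous \<tau> x R" and n: "n \<ge> \<tau> + N" for \<tau> x R n
  proof -
    have R: "R \<ge> 0" using hom by (simp add: homogeneous_def)
    have "real N * norm (x (int n)) \<le> (K * real N powr b) * R" using K[OF hom N(1) n] by (simp add: mult_ac)
    also have "\<dots> \<le> real N / 2 * R" using N R by (intro mult_right_mono) auto
    also have "\<dots> = real N * (R / 2)" by simp
    finally show ?thesis using N by (subst (asm) mult_le_cancel_left_pos) auto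
  qed
  then show ?thesis using N(1) by (intro exI[of _ N]) auto
qed

lemma homogeneous_exponential_decay:
  assumes "P > 1 \<or> a < 1"
  shows "\<exists>K \<nu>. K \<ge> 1 \<and> \<nu> > 0 \<and> (\<forall>\<tau> x R n. homogeneous \<tau> x R \<and> n > \<tau> \<longrightarrow>
    norm (x (int n)) \<le> K * exp (- \<nu> * (real n - real \<tau>)) * R)"
proof -
  obtain C1 where C1: "C1 \<ge> 1" and bd: "\<And>\<tau> x R n. homogeneous \<tau> x R \<Longrightarrow> n > \<tau> \<Longrightarrow>
      norm (x (int n)) \<le> C1 * R"
    using homogeneous_bounded by blast
  obtain N0 where half: "\<And>\<tau> x R n. homogeneous \<tau> x R \<Longrightarrow> n \<ge> \<tau> + N0 \<Longrightarrow> norm (x (int n)) \<le> R / 2"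
    and N0: "N0 \<ge> 1"
    using homogeneous_half[OF assms] by blast
  \<comment> \<open>The \<open>d\<close> extra steps put all \<open>d\<close> history values at the
    end of a block into the range where halving holds.\<close>
  define N where "N = N0 + d"
  have N: "N \<ge> 1" using N0 by (simp add: N_def)
  have iter: "norm (x (int n)) \<le> C1 * R / 2 ^ j" if "homogeneous \<tau> x R" "n > \<tau> + j * N" for \<tau> x R n j
    using that
  proof (induction j arbitrary: \<tau> R)
    case 0
    then show ?case using bd by simp
  next
    case (Suc j)
    have "homogeneous (\<tau> + N) x (R / 2)"
    proof (rule homogeneous_restart[OF Suc.prems(1)])
      show "R / 2 \<ge> 0" using Suc.prems by (simp add: homogeneous_def)
      fix k assume "k < d"
      then have "int (\<tau> + N) - int k = int (\<tau> + N - k)" "\<tau> + N - k \<ge> \<tau> + N0" by (auto simp: N_def)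
      then show "norm (x (int (\<tau> + N) - int k)) \<le> R / 2" using half[OF Suc.prems(1)] by metis
    qed simp
    from Suc.IH[OF this] Suc.prems show ?case by (simp add: field_simps)
  qed
  define \<nu> where "\<nu> = ln 2 / real N"
  show ?thesis
  proof (rule exI[of _ "2 * C1"], rule exI[of _ \<nu>], intro conjI allI impI)
    show "2 * C1 \<ge> 1" using C1 by simp
    show "\<nu> > 0" using N by (simp add: \<nu>_def)
    fix \<tau> n :: nat and x R
    assume "homogeneous \<tau> x R \<and> n > \<tau>"
    then have hom: "homogeneous \<tau> x R" and n: "n > \<tau>" by auto
    have R: "R \<ge> 0" using hom by (simp add: homogeneous_def)
    \<comment> \<open>Subtracting 1 keeps \<open>n > \<tau> + j * N\<close>, as \<open>iter\<close>
      demands; rounding loses at most one block, paid for by the factor 2 in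
      \<open>2 * C1\<close>.\<close>
    define j where "j = (n - \<tau> - 1) div N"
    have "j * N \<le> n - \<tau> - 1" unfolding j_def by (rule div_times_less_eq_dividend)
    then have "n > \<tau> + j * N" using n by simp
    then have "norm (x (int n)) \<le> C1 * R / 2 ^ j" using iter[OF hom] by blast
    also have "1 / 2 ^ j \<le> 2 * exp (- \<nu> * (real n - real \<tau>))"
    proof -
      have "n - \<tau> - 1 < (j + 1) * N"
        unfolding j_def using N dividend_less_times_div[of N "n - \<tau> - 1"] by (simp add: algebra_simps)
      then have "n - \<tau> \<le> (j + 1) * N" by simp
      then have "real (n - \<tau>) \<le> real ((j + 1) * N)" by (simp only: of_nat_le_iff)
      then have le: "real n - real \<tau> \<le> real (j + 1) * real N" using n by (simp only: of_nat_diff of_nat_mult less_imp_le)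
      have "\<nu> * (real n - real \<tau>) \<le> \<nu> * (real (j + 1) * real N)"
        using le N by (intro mult_left_mono) (auto simp: \<nu>_def)
      also have "\<dots> = real (j + 1) * ln 2" using N by (simp add: \<nu>_def)
      finally have "exp (\<nu> * (real n - real \<tau>)) \<le> exp (real (j + 1) * ln 2)" by simp
      also have "\<dots> = 2 ^ (j + 1)" by (subst exp_of_nat_mult) simp
      finally have "exp (\<nu> * (real n - real \<tau>)) \<le> 2 * 2 ^ j" by simp
      moreover have "exp (- \<nu> * (real n - real \<tau>)) = 1 / exp (\<nu> * (real n - real \<tau>))"
        by (simp only: mult_minus_left exp_minus inverse_eq_divide)
      ultimately show ?thesis by (simp only: divide_le_eq mult.commute) (simp add: field_simps)
    qed
    then have "C1 * R / 2 ^ j \<le> C1 * R * (2 * exp (- \<nu> * (real n - real \<tau>)))"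
      using mult_left_mono[of "1 / 2 ^ j" _ "C1 * R"] C1 R by simp
    finally show "norm (x (int n)) \<le> 2 * C1 * exp (- \<nu> * (real n - real \<tau>)) * R"
      by (simp add: mult_ac)
  qed
qed

text \<open>The phase space enters only through control of the most recent coordinates. The bound
  \<open>max d 1\<close> replaces \<open>d\<close> because at \<open>n = \<tau>\<close> the value
  \<open>\<phi> 0\<close> itself has to be bounded, also for order 0.\<close>

lemma unif_exp_stableI:
  assumes "P > 1 \<or> a < 1" and E: "E \<ge> 1"
    and N: "\<And>\<phi> k. \<phi> \<in> B \<Longrightarrow> k < max d 1 \<Longrightarrow> norm (\<phi> k) \<le> E * N \<phi>"
  shows "unif_exp_stable L B N"
proof -
  obtain K \<nu> where K: "K \<ge> 1" and \<nu>: "\<nu> > 0" and decay: "\<And>\<tau> x R n. homogeneous \<tau> x R \<Longrightarrow> n > \<tau> \<Longrightarrow>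
    norm (x (int n)) \<le> K * exp (- \<nu> * (real n - real \<tau>)) * R"
    using homogeneous_exponential_decay[OF assms(1)] by blast
  show ?thesis unfolding unif_exp_stable_def
  proof (rule exI[of _ "K * E"], rule exI[of _ \<nu>], intro conjI allI ballI impI \<nu>)
    show "K * E \<ge> 1" using mult_mono[OF K E] K by simp
    fix \<tau> n :: nat and \<phi> assume \<phi>: "\<phi> \<in> B" and n: "\<tau> \<le> n"
    define x where "x = solution L \<tau> \<phi> (\<lambda>_. 0)"
    have hist: "x (int \<tau> - int k) = \<phi> k" for k by (simp add: x_def solution_hist)
    have N0: "E * N \<phi> \<ge> 0" using N[OF \<phi>, of 0] norm_ge_zero[of "\<phi> 0"] by linarith
    have hom: "homogeneous \<tau> x (E * N \<phi>)"
      using N[OF \<phi>] N0 by (auto simp: homogeneous_def x_def solution_Suc solution_hist)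
    show "norm (solution L \<tau> \<phi> (\<lambda>_. 0) (int n)) \<le>
        K * E * exp (- \<nu> * (real n - real \<tau>)) * N \<phi>"
    proof (cases "n = \<tau>")
      case True
      have "norm (x (int n)) = norm (\<phi> 0)" using hist[of 0] True by simp
      also have "\<dots> \<le> 1 * (E * N \<phi>)" using N[OF \<phi>, of 0] by simp
      also have "\<dots> \<le> K * (E * N \<phi>)" using K N0 by (intro mult_right_mono)
      finally show ?thesis using True by (simp add: x_def)
    next
      case False
      then have "norm (x (int n)) \<le> K * exp (- \<nu> * (real n - real \<tau>)) * (E * N \<phi>)"
        using n by (intro decay[OF hom]) auto
      then show ?thesis by (simp add: x_def mult_ac)
    qed
  qed
qed

end

section \<open>Equivalence of the stability notions\<close>

text \<open>Hoelder's inequality, obtained as Jensen's inequality with equal weights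
  \<open>1/N\<close>; the full series \<open>T\<close> bounds the powers in every window.\<close>

lemma lp_window_sum_le:
  fixes x :: "nat \<Rightarrow> 'a::real_normed_vector"
  assumes Q: "Q \<ge> 1" and x: "x \<in> lp (ennreal Q)"
  shows "\<exists>C. \<forall>m N. (\<Sum>n\<in>{m..<m+N}. norm (x n)) \<le> C * real N powr (1 - 1/Q)"
proof (intro exI allI)
  define T where "T = (\<Sum>n. norm (x n) powr Q)"
  have sm: "summable (\<lambda>n. norm (x n) powr Q)" using x Q by (simp add: lp_finite)
  have T: "T \<ge> 0" unfolding T_def by (intro suminf_nonneg sm) simp
  fix m N
  show "(\<Sum>n\<in>{m..<m+N}. norm (x n)) \<le> T powr (1/Q) * real N powr (1 - 1/Q)"
  proof (cases "N = 0")
    case False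
    then have N: "real N > 0" by simp
    define s where "s = (\<Sum>n\<in>{m..<m+N}. norm (x n))"
    have s: "s \<ge> 0" unfolding s_def by (intro sum_nonneg) auto
    have "(\<Sum>n\<in>{m..<m+N}. 1 / real N * norm (x n)) powr Q \<le>
        (\<Sum>n\<in>{m..<m+N}. 1 / real N * norm (x n) powr Q)"
      using N by (intro jensen_powr Q) auto
    then have "(s / real N) powr Q \<le> (\<Sum>n\<in>{m..<m+N}. norm (x n) powr Q) / real N"
      by (simp add: s_def flip: sum_divide_distrib)
    also have "\<dots> \<le> T / real N"
      unfolding T_def using N by (intro divide_right_mono sum_le_suminf sm) auto
    finally have "((s / real N) powr Q) powr (1/Q) \<le> (T / real N) powr (1/Q)"
      using Q by (intro powr_mono2) auto
    then have "s / real N \<le> T powr (1/Q) / real N powr (1/Q)"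
      using Q s N T by (simp add: powr_powr powr_divide)
    then have "s \<le> T powr (1/Q) * (real N / real N powr (1/Q))"
      using N by (simp add: field_simps)
    also have "real N / real N powr (1/Q) = real N powr (1 - 1/Q)"
      using N by (simp add: powr_diff)
    finally show ?thesis by (simp add: s_def)
  qed simp
qed

text \<open>Young's inequality for a geometric kernel. Multiplied by \<open>1 - r\<close>, the
  kernel has mass at most 1. For finite \<open>p\<close>, Jensen's inequality then applies at each
  \<open>n\<close>, and the resulting bound is a Cauchy product of two summable sequences.\<close>

lemma geometric_convolution_lp:
  fixes f y :: "nat \<Rightarrow> 'a::real_normed_vector"
  assumes p: "1 \<le> p" and f: "f \<in> lp p" and r: "0 < r" "r < 1" and K: "K \<ge> 0"
    and y: "\<And>n. norm (y (Suc n)) \<le> K * (\<Sum>j\<le>n. norm (f j) * r ^ (n - j))"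
  shows "y \<in> lp p"
proof -
  have geo: "(\<Sum>j\<le>n. (1 - r) * r ^ (n - j)) \<le> 1" for n
  proof -
    have "(\<Sum>j\<le>n. (1 - r) * r ^ (n - j)) = (1 - r) * (\<Sum>j\<le>n. r ^ j)"
      unfolding sum_distrib_left by (rule sum.nat_diff_reindex[of "\<lambda>j. (1 - r) * r ^ j" "Suc n", unfolded lessThan_Suc_atMost, simplified])
    also have "\<dots> = 1 - r ^ Suc n" using r by (simp add: sum_gp0)
    finally show ?thesis using r by simp
  qed
  from p show ?thesis
  proof (cases rule: ennreal_ge_1_cases)
    case top
    then obtain F where F: "\<And>n. norm (f n) \<le> F" using f by (auto simp: lp_top bounded_iff)
    then have F0: "F \<ge> 0" using norm_ge_zero order_trans by blast
    have "norm (y n) \<le> max (norm (y 0)) (K * (F / (1 - r)))" for n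
    proof (cases n)
      case (Suc m)
      have "(\<Sum>j\<le>m. norm (f j) * r ^ (m - j)) \<le> (\<Sum>j\<le>m. F * r ^ (m - j))"
        using F r by (intro sum_mono mult_right_mono) auto
      also have "\<dots> = F / (1 - r) * (\<Sum>j\<le>m. (1 - r) * r ^ (m - j))"
        using r by (simp flip: sum_distrib_left)
      also have "\<dots> \<le> F / (1 - r) * 1" using F0 r geo by (intro mult_left_mono) auto
      finally have "K * (\<Sum>j\<le>m. norm (f j) * r ^ (m - j)) \<le> K * (F / (1 - r))"
        using K by (intro mult_left_mono) auto
      then show ?thesis using y[of m] Suc by (simp add: le_max_iff_disj)
    qed simp
    then show ?thesis using top by (auto simp: lp_top bounded_iff)
  next
    case (real P)
    then have sf: "summable (\<lambda>n. norm (f n) powr P)" using f by (simp add: lp_finite)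
    have "summable (\<lambda>n. \<Sum>j\<le>n. norm (f j) powr P * r ^ (n - j))"
      using sf r by (intro summable_Cauchy_product) (auto simp: summable_geometric norm_power)
    then have sc: "summable (\<lambda>n. (K / (1 - r)) powr P * ((1 - r) * (\<Sum>j\<le>n. norm (f j) powr P * r ^ (n - j))))"
      by (intro summable_mult)
    have "summable (\<lambda>n. norm (y (Suc n)) powr P)"
    proof (rule summable_comparison_test'[OF sc, of 0])
      fix n
      have "norm (y (Suc n)) \<le> K / (1 - r) * (\<Sum>j\<le>n. ((1 - r) * r ^ (n - j)) * norm (f j))"
        using y[of n] r by (simp add: mult.assoc mult.commute[of "norm _"] flip: sum_distrib_left)
      then have "norm (y (Suc n)) powr P \<le>
          (K / (1 - r) * (\<Sum>j\<le>n. ((1 - r) * r ^ (n - j)) * norm (f j))) powr P"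
        using real by (intro powr_mono2) auto
      also have "\<dots> = (K / (1 - r)) powr P * (\<Sum>j\<le>n. ((1 - r) * r ^ (n - j)) * norm (f j)) powr P"
        by (rule powr_mult)
      also have "\<dots> \<le> (K / (1 - r)) powr P * (\<Sum>j\<le>n. ((1 - r) * r ^ (n - j)) * norm (f j) powr P)"
        using real r geo by (intro mult_left_mono jensen_powr) auto
      also have "(\<Sum>j\<le>n. ((1 - r) * r ^ (n - j)) * norm (f j) powr P) =
          (1 - r) * (\<Sum>j\<le>n. norm (f j) powr P * r ^ (n - j))"
        by (simp add: sum_distrib_left mult_ac)
      finally show "norm (norm (y (Suc n)) powr P) \<le>
          (K / (1 - r)) powr P * ((1 - r) * (\<Sum>j\<le>n. norm (f j) powr P * r ^ (n - j)))" by simp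
    qed
    then show ?thesis
      using real summable_Suc_iff[of "\<lambda>n. norm (y n) powr P"] by (simp add: lp_finite)
  qed
qed

section \<open>Norms of the phase spaces\<close>

lemma Bnorm_coord_hist: "Bnorm \<gamma> (coord_hist 0 \<psi>) = norm \<psi>" (is ?A)
  and coord_hist_in_Bspace: "coord_hist 0 \<psi> \<in> Bspace \<gamma>" (is ?B)
proof -
  let ?f = "\<lambda>k. norm (coord_hist 0 \<psi> k) * exp (\<gamma> * (- real k))"
  have le: "?f k \<le> norm \<psi>" for k by (simp add: coord_hist_def)
  then show ?B by (auto simp: Bspace_def bdd_above_def)
  show ?A unfolding Bnorm_def
  proof (rule antisym)
    show "(SUP k. ?f k) \<le> norm \<psi>" by (rule cSUP_least) (use le in auto)
    have "?f 0 \<le> (SUP k. ?f k)"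
      by (rule cSUP_upper) (use le in \<open>auto simp: bdd_above_def\<close>)
    then show "norm \<psi> \<le> (SUP k. ?f k)" by (simp add: coord_hist_def)
  qed
qed

lemma norm_le_Bnorm:
  assumes "\<phi> \<in> Bspace \<gamma>"
  shows "norm (\<phi> k) * exp (\<gamma> * (- real k)) \<le> Bnorm \<gamma> \<phi>"
  using assms unfolding Bnorm_def Bspace_def by (intro cSUP_upper) auto

lemma norm_le_Bseminorm:
  assumes "k \<le> j"
  shows "norm (\<phi> k) * exp (\<gamma> * (- real k)) \<le> Bseminorm \<gamma> j \<phi>"
  using assms unfolding Bseminorm_def by (intro cSUP_upper) (auto intro: bdd_above_finite)

lemma Bseminorm_le_Bnorm: "\<phi> \<in> Bspace \<gamma> \<Longrightarrow> Bseminorm \<gamma> j \<phi> \<le> Bnorm \<gamma> \<phi>"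
  unfolding Bseminorm_def by (rule cSUP_least) (use norm_le_Bnorm in auto)

lemma unif_exp_stable_mono:
  assumes "unif_exp_stable L B N" "B' \<subseteq> B" "\<And>\<phi>. \<phi> \<in> B' \<Longrightarrow> N \<phi> \<le> N' \<phi>"
  shows "unif_exp_stable L B' N'"
proof -
  obtain K \<nu> where K: "K \<ge> 1" "\<nu> > 0" and st: "\<And>\<tau> n \<phi>. \<phi> \<in> B \<Longrightarrow> n \<ge> \<tau> \<Longrightarrow>
      norm (solution L \<tau> \<phi> (\<lambda>_. 0) (int n)) \<le> K * exp (- \<nu> * (real n - real \<tau>)) * N \<phi>"
    using assms(1) unfolding unif_exp_stable_def by blast
  have "norm (solution L \<tau> \<phi> (\<lambda>_. 0) (int n)) \<le> K * exp (- \<nu> * (real n - real \<tau>)) * N' \<phi>"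
    if "\<phi> \<in> B'" "n \<ge> \<tau>" for \<tau> n \<phi>
  proof -
    have "norm (solution L \<tau> \<phi> (\<lambda>_. 0) (int n)) \<le> K * exp (- \<nu> * (real n - real \<tau>)) * N \<phi>"
      using st that assms(2) by blast
    also have "\<dots> \<le> K * exp (- \<nu> * (real n - real \<tau>)) * N' \<phi>"
      using K assms(3)[OF that(1)] by (intro mult_left_mono) auto
    finally show ?thesis .
  qed
  then show ?thesis unfolding unif_exp_stable_def using K by blast
qed

context delay_system
begin

text \<open>Variation of constants: the input \<open>f j\<close> acts as the value at time
  \<open>j + 1\<close> of a homogeneous solution with zero earlier history, and these solutions
  superpose.\<close>

lemma G_eq_sum:
  "G f (int n) = (\<Sum>j<n. solution L (Suc j) (coord_hist 0 (f j)) (\<lambda>_. 0) (int n))"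
proof -
  define s where "s = (\<lambda>j. solution L (Suc j) (coord_hist 0 (f j)) (\<lambda>_. 0))"
  have s0: "s j t = 0" if "t \<le> int j" for j t
  proof -
    define k where "k = nat (int (Suc j) - t)"
    have "t = int (Suc j) - int k" "k \<noteq> 0" using that by (auto simp: k_def)
    then show ?thesis unfolding s_def using solution_hist[of "Suc j"] by (simp add: coord_hist_def)
  qed
  have s1: "s j (int j + 1) = f j" for j
    unfolding s_def using solution_hist[of "Suc j" _ _ 0] by (simp add: coord_hist_def add.commute)
  have sS: "s j (int n + 1) = (\<Sum>k<d. A n k (s j (int n - int k)))" if "n > j" for n j
    unfolding s_def using solution_Suc[of "Suc j" n] that by simp
  have "G f = (\<lambda>t. \<Sum>j<nat t. s j t)"
  proof (rule G_eqI)
    fix n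
    \<comment> \<open>At time \<open>n - k\<close> every solution with \<open>j \<ge> n - k\<close>
      is still zero, so all lags can share the range \<open>j < n\<close>.\<close>
    have cut: "(\<Sum>j<nat (int n - int k). s j (int n - int k)) = (\<Sum>j<n. s j (int n - int k))" for k
      by (rule sum.mono_neutral_left) (auto intro!: s0)
    have "nat (int n + 1) = Suc n" by simp
    then have "(\<Sum>j<nat (int n + 1). s j (int n + 1)) = (\<Sum>j<n. s j (int n + 1)) + f n"
      using s1[of n] by simp
    also have "(\<Sum>j<n. s j (int n + 1)) = (\<Sum>j<n. \<Sum>k<d. A n k (s j (int n - int k)))"
      by (rule sum.cong) (auto simp: sS)
    also have "\<dots> = (\<Sum>k<d. A n k (\<Sum>j<nat (int n - int k). s j (int n - int k)))"
      unfolding cut A_simps by (rule sum.swap)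
    finally show "(\<Sum>j<nat (int n + 1). s j (int n + 1)) =
      (\<Sum>k<d. A n k (\<Sum>j<nat (int n - int k). s j (int n - int k))) + f n" .
  qed simp
  then show ?thesis by (simp add: s_def)
qed

lemma lp_lq_stable_if_unif_exp_stable:
  assumes p: "1 \<le> p" "p \<le> q" and st: "unif_exp_stable L (Bspace \<gamma>) (Bnorm \<gamma>)"
  shows "lp_lq_stable L p q"
  unfolding lp_lq_stable_def
proof
  fix f :: "nat \<Rightarrow> 'a" assume f: "f \<in> lp p"
  obtain K \<nu> where K: "K \<ge> 1" "\<nu> > 0" and bd: "\<And>\<tau> n \<phi>. \<phi> \<in> Bspace \<gamma> \<Longrightarrow> n \<ge> \<tau> \<Longrightarrow>
      norm (solution L \<tau> \<phi> (\<lambda>_. 0) (int n)) \<le> K * exp (- \<nu> * (real n - real \<tau>)) * Bnorm \<gamma> \<phi>"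
    using st unfolding unif_exp_stable_def by blast
  have "(\<lambda>n. G f (int n)) \<in> lp p"
  proof (rule geometric_convolution_lp[OF p(1) f, of "exp (- \<nu>)" K])
    fix n
    have "norm (G f (int (Suc n))) \<le> (\<Sum>j<Suc n. K * (norm (f j) * exp (- \<nu>) ^ (n - j)))"
      unfolding G_eq_sum
    proof (rule sum_norm_le)
      fix j assume "j \<in> {..<Suc n}"
      then have j: "j \<le> n" by simp
      have "exp (- \<nu>) ^ (n - j) = exp (- \<nu> * (real (Suc n) - real (Suc j)))"
        using j by (simp add: of_nat_diff mult.commute flip: exp_of_nat_mult)
      then show "norm (solution L (Suc j) (coord_hist 0 (f j)) (\<lambda>_. 0) (int (Suc n)))
          \<le> K * (norm (f j) * exp (- \<nu>) ^ (n - j))"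
        using bd[OF coord_hist_in_Bspace, of "Suc j" "Suc n" "f j"] j
        by (simp add: Bnorm_coord_hist mult_ac)
    qed
    then show "norm (G f (int (Suc n))) \<le> K * (\<Sum>j\<le>n. norm (f j) * exp (- \<nu>) ^ (n - j))"
      unfolding lessThan_Suc_atMost sum_distrib_left .
  qed (use K in auto)
  then show "(\<lambda>n. solution L 0 (\<lambda>_. 0) f (int n)) \<in> lp q"
    using lp_mono[OF p] unfolding G_def by blast
qed

text \<open>For finite \<open>q\<close>, inputs from the unit ball with \<open>P = 1\<close> suffice
  and \<open>a = 1 - 1/q < 1\<close>. For \<open>q = \<infinity>\<close> the outputs are only
  bounded, so \<open>a = 1\<close>, and excluding \<open>(1, \<infinity>)\<close> leaves room for a
  finite \<open>P\<close> with \<open>1 < P \<le> p\<close>.\<close>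

lemma stable_delay_system_if_lp_lq_stable:
  assumes p: "1 \<le> p" "p \<le> q" "(p, q) \<noteq> (1, \<infinity>)" and st: "lp_lq_stable L p q"
  shows "\<exists>P a C. stable_delay_system L P a C \<and> (P > 1 \<or> a < 1)"
proof -
  have G: "(\<lambda>n. G f (int n)) \<in> lp q" if "f \<in> lp p" for f
    using st that unfolding lp_lq_stable_def G_def by blast
  obtain P a where P: "P \<ge> 1" and a: "a \<ge> 0" "P > 1 \<or> a < 1" and
    pw: "\<And>f. f \<in> lp_ball P \<Longrightarrow>
      \<exists>C. \<forall>m N. (\<Sum>n\<in>{m..<m+N}. norm (G f (int n))) \<le> C * real N powr a"
  proof -
    have "1 \<le> q" using p by order
    then show ?thesis
    proof (cases rule: ennreal_ge_1_cases)
      case (real Q)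
      show ?thesis
      proof (rule that[of 1 "1 - 1/Q"])
        fix f :: "nat \<Rightarrow> 'a" assume "f \<in> lp_ball 1"
        then have "f \<in> lp (ennreal 1)" by (rule lp_ball_subset_lp) simp
        then have "f \<in> lp p" using lp_mono[OF _ p(1)] by auto
        then show "\<exists>C. \<forall>m N. (\<Sum>n\<in>{m..<m+N}. norm (G f (int n))) \<le> C * real N powr (1 - 1/Q)"
          using G real by (intro lp_window_sum_le) auto
      qed (use real in auto)
    next
      case top
      obtain P where P: "P > 1" "ennreal P \<le> p"
      proof (cases "p = top")
        case True
        then show ?thesis using that[of 2] by simp
      next
        case False
        with p(1) obtain P where P: "P \<ge> 1" "p = ennreal P" by (cases rule: ennreal_ge_1_cases) auto
        moreover have "P \<noteq> 1" using P p(3) top by auto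
        ultimately show ?thesis using that[of P] by simp
      qed
      show ?thesis
      proof (rule that[of P 1])
        fix f :: "nat \<Rightarrow> 'a" assume "f \<in> lp_ball P"
        then have "f \<in> lp (ennreal P)" using P by (intro lp_ball_subset_lp) auto
        then have "f \<in> lp p" using lp_mono[of "ennreal P" p] P by auto
        then obtain F where F: "\<And>n. norm (G f (int n)) \<le> F"
          using G[of f] top by (auto simp: lp_top bounded_iff)
        have "(\<Sum>n\<in>{m..<m+N}. norm (G f (int n))) \<le> F * real N powr 1" for m N
          using sum_bounded_above[of "{m..<m+N}" "\<lambda>n. norm (G f (int n))" F] F by (simp add: mult.commute)
        then show "\<exists>C. \<forall>m N. (\<Sum>n\<in>{m..<m+N}. norm (G f (int n))) \<le> C * real N powr 1" by blast
      qed (use P in auto)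
    qed
  qed
  obtain C where "C \<ge> 1" "\<And>f m N. f \<in> lp_ball P \<Longrightarrow>
      (\<Sum>n\<in>{m..<m+N}. norm (G f (int n))) \<le> C * real N powr a"
    using G_uniform_bound[OF P pw] by blast
  then have "stable_delay_system L P a C"
    using P a by unfold_locales auto
  then show ?thesis using a by blast
qed

text \<open>Leaving \<open>B\<close> and \<open>N\<close> open serves both phase spaces. For the
  finitely many \<open>k < max d 1\<close> the weights stay above a positive constant, so the
  weighted hypothesis controls the plain norms for either sign of \<open>\<gamma>\<close>.\<close>

lemma unif_exp_stable_if_lp_lq_stable:
  assumes "1 \<le> p" "p \<le> q" "(p, q) \<noteq> (1, \<infinity>)" "lp_lq_stable L p q"
    and N: "\<And>\<phi> k. \<phi> \<in> B \<Longrightarrow> k < max d 1 \<Longrightarrow> norm (\<phi> k) * exp (\<gamma> * (- real k)) \<le> N \<phi>"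
  shows "unif_exp_stable L B N"
proof -
  obtain P a C where "stable_delay_system L P a C" and Pa: "P > 1 \<or> a < 1"
    using stable_delay_system_if_lp_lq_stable[OF assms(1-4)] by blast
  then interpret S: stable_delay_system L P a C by simp
  show ?thesis
  proof (rule S.unif_exp_stableI[OF Pa, of "exp (\<bar>\<gamma>\<bar> * real (max d 1))"])
    fix \<phi> k assume \<phi>: "\<phi> \<in> B" and k: "k < max d 1"
    have "norm (\<phi> k) = exp (\<gamma> * real k) * (norm (\<phi> k) * exp (\<gamma> * (- real k)))"
      by (simp add: exp_minus)
    also have "\<dots> \<le> exp (\<bar>\<gamma>\<bar> * real (max d 1)) * N \<phi>"
    proof (intro mult_mono N[OF \<phi> k])
      have "\<gamma> * real k \<le> \<bar>\<gamma>\<bar> * real k" by (intro mult_right_mono) auto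
      also have "\<dots> \<le> \<bar>\<gamma>\<bar> * real (max d 1)" using k by (intro mult_left_mono) auto
      finally show "exp (\<gamma> * real k) \<le> exp (\<bar>\<gamma>\<bar> * real (max d 1))" by simp
    qed auto
    finally show "norm (\<phi> k) \<le> exp (\<bar>\<gamma>\<bar> * real (max d 1)) * N \<phi>" .
  qed simp
qed

end

theorem corollary3p7:
  fixes L :: "nat \<Rightarrow> (nat \<Rightarrow> 'a::banach) \<Rightarrow> 'a"
    and \<gamma> :: real and p q :: ennreal and d :: nat
  assumes "1 \<le> p" and "p \<le> q" and "(p, q) \<noteq> (1, \<infinity>)"
    and "bounded_delay L" and "delay_order L = d"
  shows "(unif_exp_stable L (Bspace \<gamma>) (Bnorm \<gamma>) \<longleftrightarrow> lp_lq_stable L p q) \<and>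
         (d \<ge> 1 \<longrightarrow>
           (unif_exp_stable L UNIV (Bseminorm \<gamma> (d - 1)) \<longleftrightarrow>
            unif_exp_stable L (Bspace \<gamma>) (Bnorm \<gamma>)))"
proof -
  interpret delay_system L by unfold_locales (rule assms(4))
  have 1: "lp_lq_stable L p q" if "unif_exp_stable L (Bspace \<gamma>) (Bnorm \<gamma>)"
    using lp_lq_stable_if_unif_exp_stable[OF assms(1,2) that] .
  have 2: "unif_exp_stable L (Bspace \<gamma>) (Bnorm \<gamma>)" if "lp_lq_stable L p q"
    by (rule unif_exp_stable_if_lp_lq_stable[OF assms(1-3) that, where \<gamma> = \<gamma>]) (rule norm_le_Bnorm)
  \<comment> \<open>For \<open>d \<ge> 1\<close>, \<open>k < max d 1\<close> means
    \<open>k \<le> d - 1\<close>, the range of the seminorm.\<close>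
  have 3: "unif_exp_stable L UNIV (Bseminorm \<gamma> (d - 1))" if "d \<ge> 1" "lp_lq_stable L p q"
    by (rule unif_exp_stable_if_lp_lq_stable[OF assms(1-3) that(2), where \<gamma> = \<gamma>], rule norm_le_Bseminorm)
      (use that(1) assms(5) in auto)
  have 4: "unif_exp_stable L (Bspace \<gamma>) (Bnorm \<gamma>)" if "unif_exp_stable L UNIV (Bseminorm \<gamma> (d - 1))"
    by (rule unif_exp_stable_mono[OF that]) (auto intro: Bseminorm_le_Bnorm)
  \<comment> \<open>The step from the norm to the seminorm passes through
    \<open>lp_lq_stable\<close>, by \<open>1\<close> and then \<open>3\<close>.\<close>
  show ?thesis using 1 2 3 4 by blast
qed

end
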